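(* Let $d=6$ and $\lambda=1$. There exists a constant $\chi>0$ such that whenever $|p^+-\beta|<\chi$ and $|p^--\alpha|<\chi$, the function $g_{\alpha,\beta}(\gamma,\delta,\epsilon)=f(\alpha,\beta,\gamma,\delta,\epsilon)$ attains its unique maximum over the region $\mathcal R_{\alpha,\beta}$ at the point $(\gamma^*,\delta^*,\epsilon^* )=(\alpha^2,\beta^2,\alpha(1-\alpha-\beta))$.
   Context: **Densities.** Here $\lambda=1>\lambda_c(6)=5^5/4^6$. Let $\mu_+$ (resp. $\mu_-$) be the Gibbs measure of the hardcore model with fugacity $\lambda$ on the infinite $d$-regular tree with root $\rho$ obtained by conditioning level $2\ell$ (resp. $2\ell+1$) to be fully occupied and letting $\ell\to\infty$; $p^\pm=\mu_\pm(\sigma_\rho=1)$. It is known that $p^-<p^+$ and that, with $h(x)=(1-x)\big[1-(\tfrac{x}{\lambda(1-x)})^{1/d}\big]$, the solutions of $h(\alpha)=\beta$, $h(\beta)=\alpha$ with $\alpha,\beta\ge0$, $\alpha+\beta\le1$ are exactly $(p^+,p^-)$, $(p^-,p^+)$ and a diagonal point $(p^*,p^* )$ with $p^-<p^*<p^+$; numerically $p^+\approx0.40831988$, $p^-\approx0.03546955$. **The function $f$.** Let $H_1(x,y)=-x(\log x-\log y)+(x-y)(\log(y-x)-\log y)$ (with $0\log0=0$), $H(x)=H_1(x,1)$, and $$\begin{aligned}f(\alpha,\beta,\gamma,\delta,\epsilon)={}&2(\alpha+\beta)\log\lambda+H(\alpha)+H_1(\gamma,\alpha)+H_1(\alpha-\gamma,1-\alpha)+H(\beta)+H_1(\delta,\beta)+H_1(\beta-\delta,1-\beta)\\&+d\big[H_1(\gamma,1-2\beta+\delta)-H(\gamma)+H_1(\epsilon,1-2\beta+\delta-\gamma)+H_1(\alpha-\gamma-\epsilon,\beta-\delta)\\&\quad-H_1(\alpha-\gamma,1-\gamma)+H_1(\alpha-\gamma,1-\beta-\gamma-\epsilon)-H_1(\alpha-\gamma,1-\alpha)\big],\end{aligned}$$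 for $\alpha,\beta\ge0$, $\alpha+\beta\le1$. The region $\mathcal R_{\alpha,\beta}$ is the set of $(\gamma,\delta,\epsilon)$ with $\alpha-\gamma-\epsilon\ge0$, $\beta-\delta\ge0$, $1-2\beta+\delta-\gamma-\epsilon\ge0$, restricted to $\gamma,\delta,\epsilon\ge 0$ at which every term $H_1(x,y)$ above is defined, i.e. has $0\le x\le y$. *)

theory Defs
  imports "HOL-Probability.Probability"
begin

text \<open>
  The infinite \<open>d\<close>-regular tree: a vertex is the list of branch choices on the path from the
  root, so the root has \<open>d\<close> children and every other vertex has \<open>d - 1\<close>.
\<close>

definition tree_vertices :: "nat \<Rightarrow> nat list set" where
  "tree_vertices d = {v. \<forall>i<length v. v ! i < (if i = 0 then d else d - 1)}"

definition tree_adj :: "nat list \<Rightarrow> nat list \<Rightarrow> bool" where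
  "tree_adj u v \<longleftrightarrow> (\<exists>i. v = u @ [i] \<or> u = v @ [i])"

definition tree_root :: "nat list" where
  "tree_root = []"

definition tree_ball :: "nat \<Rightarrow> nat \<Rightarrow> nat list set" where
  "tree_ball d n = {v \<in> tree_vertices d. length v \<le> n}"

definition tree_level :: "nat \<Rightarrow> nat \<Rightarrow> nat list set" where
  "tree_level d n = {v \<in> tree_vertices d. length v = n}"

text \<open>
  The hardcore model with fugacity \<open>lam\<close> on a finite graph. Configurations are represented by
  their sets of occupied vertices, and events by sets of such sets.
\<close>

definition independent_sets :: "'v set \<Rightarrow> ('v \<Rightarrow> 'v \<Rightarrow> bool) \<Rightarrow> 'v set set" where
  "independent_sets V adj = {I. I \<subseteq> V \<and> (\<forall>u\<in>I. \<forall>v\<in>I. \<not> adj u v)}"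

definition hardcore_prob ::
    "'v set \<Rightarrow> ('v \<Rightarrow> 'v \<Rightarrow> bool) \<Rightarrow> real \<Rightarrow> 'v set set \<Rightarrow> real" where
  "hardcore_prob V adj lam S =
     (\<Sum>I\<in>independent_sets V adj \<inter> S. lam ^ card I) / (\<Sum>I\<in>independent_sets V adj. lam ^ card I)"

definition hardcore_cond_prob ::
    "'v set \<Rightarrow> ('v \<Rightarrow> 'v \<Rightarrow> bool) \<Rightarrow> real \<Rightarrow> 'v set set \<Rightarrow> 'v set set \<Rightarrow> real" where
  "hardcore_cond_prob V adj lam S C =
     hardcore_prob V adj lam (S \<inter> C) / hardcore_prob V adj lam C"

definition full_level_prob :: "nat \<Rightarrow> real \<Rightarrow> nat \<Rightarrow> nat list set set \<Rightarrow> real" where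
  "full_level_prob d lam n S =
     hardcore_cond_prob (tree_ball d n) tree_adj lam S {I. tree_level d n \<subseteq> I}"

text \<open>
  \<open>M\<close> is the limit, as \<open>l\<close> tends to infinity, of the hardcore measures conditioned on level
  \<open>n l\<close> being fully occupied. Convergence is that of the probabilities of all cylinder events
  (weak convergence for the product topology), which determines \<open>M\<close> uniquely.
\<close>

definition full_level_limit ::
    "nat \<Rightarrow> real \<Rightarrow> (nat \<Rightarrow> nat) \<Rightarrow> (nat list \<Rightarrow> bool) measure \<Rightarrow> bool" where
  "full_level_limit d lam n M \<longleftrightarrow>
     prob_space M \<and>
     sets M = sets (PiM (tree_vertices d) (\<lambda>_. count_space (UNIV :: bool set))) \<and>
     (\<forall>A B. finite A \<and> A \<subseteq> tree_vertices d \<and> B \<subseteq> A \<longrightarrow>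
        (\<lambda>l. full_level_prob d lam (n l) {I. I \<inter> A = B})
          \<longlonglongrightarrow> measure M {\<sigma> \<in> space M. \<forall>v\<in>A. \<sigma> v \<longleftrightarrow> v \<in> B})"

definition gibbs_plus :: "nat \<Rightarrow> real \<Rightarrow> (nat list \<Rightarrow> bool) measure \<Rightarrow> bool" where
  "gibbs_plus d lam M \<longleftrightarrow> full_level_limit d lam (\<lambda>l. 2 * l) M"

definition gibbs_minus :: "nat \<Rightarrow> real \<Rightarrow> (nat list \<Rightarrow> bool) measure \<Rightarrow> bool" where
  "gibbs_minus d lam M \<longleftrightarrow> full_level_limit d lam (\<lambda>l. 2 * l + 1) M"

definition root_density :: "(nat list \<Rightarrow> bool) measure \<Rightarrow> real" where
  "root_density M = measure M {\<sigma> \<in> space M. \<sigma> tree_root}"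

text \<open>
  On \<open>0 \<le> x \<le> y\<close> every logarithm of \<open>0\<close> below is multiplied by \<open>0\<close>, so the convention
  \<open>0 log 0 = 0\<close> holds automatically.
\<close>

definition H1 :: "real \<Rightarrow> real \<Rightarrow> real" where
  "H1 x y = - x * (ln x - ln y) + (x - y) * (ln (y - x) - ln y)"

definition H_fun :: "real \<Rightarrow> real" where
  "H_fun x = H1 x 1"

definition H1_defined :: "real \<Rightarrow> real \<Rightarrow> bool" where
  "H1_defined x y \<longleftrightarrow> 0 \<le> x \<and> x \<le> y"

definition f_fun :: "nat \<Rightarrow> real \<Rightarrow> real \<Rightarrow> real \<Rightarrow> real \<Rightarrow> real \<Rightarrow> real \<Rightarrow> real" where
  "f_fun d lam \<alpha> \<beta> \<gamma> \<delta> \<epsilon> =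
     2 * (\<alpha> + \<beta>) * ln lam
     + H_fun \<alpha> + H1 \<gamma> \<alpha> + H1 (\<alpha> - \<gamma>) (1 - \<alpha>)
     + H_fun \<beta> + H1 \<delta> \<beta> + H1 (\<beta> - \<delta>) (1 - \<beta>)
     + real d *
       (H1 \<gamma> (1 - 2 * \<beta> + \<delta>) - H_fun \<gamma>
        + H1 \<epsilon> (1 - 2 * \<beta> + \<delta> - \<gamma>)
        + H1 (\<alpha> - \<gamma> - \<epsilon>) (\<beta> - \<delta>)
        - H1 (\<alpha> - \<gamma>) (1 - \<gamma>)
        + H1 (\<alpha> - \<gamma>) (1 - \<beta> - \<gamma> - \<epsilon>)
        - H1 (\<alpha> - \<gamma>) (1 - \<alpha>))"

definition g_fun :: "nat \<Rightarrow> real \<Rightarrow> real \<Rightarrow> real \<Rightarrow> real \<times> real \<times> real \<Rightarrow> real" where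
  "g_fun d lam \<alpha> \<beta> = (\<lambda>(\<gamma>, \<delta>, \<epsilon>). f_fun d lam \<alpha> \<beta> \<gamma> \<delta> \<epsilon>)"

text \<open>Recall that \<open>H_fun x\<close> is \<open>H1 x 1\<close>.\<close>

definition region :: "real \<Rightarrow> real \<Rightarrow> (real \<times> real \<times> real) set" where
  "region \<alpha> \<beta> = {(\<gamma>, \<delta>, \<epsilon>).
     \<gamma> \<ge> 0 \<and> \<delta> \<ge> 0 \<and> \<epsilon> \<ge> 0 \<and>
     \<alpha> - \<gamma> - \<epsilon> \<ge> 0 \<and> \<beta> - \<delta> \<ge> 0 \<and> 1 - 2 * \<beta> + \<delta> - \<gamma> - \<epsilon> \<ge> 0 \<and>
     H1_defined \<alpha> 1 \<and> H1_defined \<gamma> \<alpha> \<and> H1_defined (\<alpha> - \<gamma>) (1 - \<alpha>) \<and>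
     H1_defined \<beta> 1 \<and> H1_defined \<delta> \<beta> \<and> H1_defined (\<beta> - \<delta>) (1 - \<beta>) \<and>
     H1_defined \<gamma> (1 - 2 * \<beta> + \<delta>) \<and> H1_defined \<gamma> 1 \<and>
     H1_defined \<epsilon> (1 - 2 * \<beta> + \<delta> - \<gamma>) \<and>
     H1_defined (\<alpha> - \<gamma> - \<epsilon>) (\<beta> - \<delta>) \<and>
     H1_defined (\<alpha> - \<gamma>) (1 - \<gamma>) \<and>
     H1_defined (\<alpha> - \<gamma>) (1 - \<beta> - \<gamma> - \<epsilon>)}"

definition attains_unique_max_on :: "('a \<Rightarrow> real) \<Rightarrow> 'a set \<Rightarrow> 'a \<Rightarrow> bool" where
  "attains_unique_max_on F R x \<longleftrightarrow> x \<in> R \<and> (\<forall>y\<in>R. y \<noteq> x \<longrightarrow> F y < F x)"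

end

(*
  The value f is the Bethe entropy 6 H(x) - 5 H(a) - 5 H(b), where x is the distribution of the pair
  of spin pairs on an edge, and a, b are its marginals on the two sides.  Let X, A, B be the same
  objects for two independent copies.  As the marginals of each single copy are prescribed, the
  inequality t ln(w/t) <= w - t turns f(x) - f(X) into at most 6 (Q - 1) with
  Q = sum_st X_st (a_s/A_s)^(5/6) (b_t/B_t)^(5/6), a bilinear form that tensorizes: it is at most 1
  as soon as the one-copy Markov operator of the hardcore edge contracts L^(6/5) into L^6.  By
  Young's inequality the latter is a statement on one rational function of one variable s.  At the
  densities of the two extremal phases its maxima are exactly the two phases, at equal heights, so
  the contraction holds globally.  For nearby densities it persists near s = 1, the only place where
  it is needed: a compactness argument excludes the rest of the region.  The densities are
  computed from the recursion for the tree.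
*)
theory Submission
  imports Defs
begin

section \<open>Entropy and the edge operator\<close>

text \<open>Tensorization costs nothing: once the first copy's spins on an edge are fixed, the
  averages of the marginal ratios over the second copy are exactly 1, since both copies have
  prescribed densities. So the one-copy bound, used once per configuration of the first copy,
  already gives Q <= 1. Sixth roots of the ratios make all of this polynomial. Why the peaks have
  equal height: the edge law of a phase has weights 1, x, y with x = (1+y)^-5 and y = (1+x)^-5, and
  rescaling s by \<open>s_high\<close> turns every constant of the rational function into 1. Its
  positive critical points are then the fixed points of the two-step tree recursion, and its value
  at a phase is symmetric in x and y. Obstacle: this is special to the exact densities. For other
  \<alpha>, \<beta> the point s = 1 stays critical, but nothing keeps the second peak from rising
  above it. Near s = 1 the contraction survives because a strict local maximum there amounts to
  linear stability of the two-step recursion, 25xy < (1+x)(1+y), an open condition.\<close>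

definition xlnx :: "real \<Rightarrow> real" where
  "xlnx t = t * ln t"

lemma xlnx_simps [simp]: "xlnx 0 = 0" "xlnx 1 = 0"
  by (simp_all add: xlnx_def)

lemma xlnx_mult:
  assumes "0 \<le> x" "0 \<le> y"
  shows "xlnx (x * y) = x * xlnx y + y * xlnx x"
proof (cases "x = 0 \<or> y = 0")
  case False
  with assms have "0 < x" "0 < y" by auto
  then show ?thesis by (simp add: xlnx_def ln_mult algebra_simps)
qed (auto simp: xlnx_def)

lemma isCont_xlnx: "isCont xlnx t"
proof (cases "t = 0")
  case True
  have r: "(xlnx \<longlongrightarrow> 0) (at_right 0)"
    unfolding xlnx_def by real_asymp
  \<comment> \<open>\<open>ln\<close> is even on the nonzero reals, so \<open>xlnx\<close> is odd
    and its left limit mirrors the right one.\<close>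
  moreover have "(xlnx \<longlongrightarrow> 0) (at_left 0)"
    using tendsto_minus[OF r]
    by (simp add: filterlim_at_left_to_right xlnx_def ln_minus)
  ultimately have "(xlnx \<longlongrightarrow> 0) (at 0)"
    by (simp add: filterlim_split_at_real)
  with True show ?thesis by (simp add: isCont_def)
next
  case False
  have "isCont (\<lambda>t. t * ln t) t"
    using False by (intro continuous_intros) auto
  then show ?thesis by (simp add: xlnx_def[abs_def])
qed

lemma continuous_on_xlnx [continuous_intros]:
  assumes "continuous_on S f"
  shows "continuous_on S (\<lambda>w. xlnx (f w))"
  using continuous_on_compose2[OF continuous_at_imp_continuous_on assms, of UNIV xlnx]
  by (auto simp: isCont_xlnx)

lemma H1_eq_xlnx:
  assumes "0 \<le> x" "x \<le> y" "w = y - x"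
  shows "H1 x y = xlnx y - xlnx x - xlnx w"
  by (simp add: assms(3) H1_def xlnx_def algebra_simps)

text \<open>Chain rule for entropy: drawing the same fraction from both parts of
  \<open>m + b\<close> loses nothing compared with drawing from the union. This breaks the last
  matching term of f into separate cells of the edge law.\<close>

lemma H1_split:
  assumes "0 \<le> x" "x \<le> m + b" "0 \<le> m" "0 \<le> b"
  shows "xlnx (m * (x / (m + b))) + xlnx (m - m * (x / (m + b)))
      + xlnx (b * (x / (m + b))) + xlnx (b - b * (x / (m + b)))
     = xlnx m + xlnx b - H1 x (m + b)"
proof (cases "m + b = 0")
  case True
  with assms have "m = 0" "b = 0" "x = 0" by auto
  then show ?thesis by (simp add: H1_def)
next
  case False
  with assms have n: "0 < m + b" by auto
  define t where "t = x / (m + b)"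
  have t: "0 \<le> t" "0 \<le> 1 - t" and x: "x = (m + b) * t" and x': "m + b - x = (m + b) * (1 - t)"
    using assms n by (auto simp: t_def field_simps)
  have "xlnx (m * t) + xlnx (m * (1 - t)) + xlnx (b * t) + xlnx (b * (1 - t))
      = xlnx m + xlnx b + (m + b) * (xlnx t + xlnx (1 - t))"
    unfolding xlnx_mult[OF assms(3) t(1)] xlnx_mult[OF assms(3) t(2)]
      xlnx_mult[OF assms(4) t(1)] xlnx_mult[OF assms(4) t(2)]
    by (simp add: algebra_simps)
  moreover have "H1 x (m + b) = - ((m + b) * (xlnx t + xlnx (1 - t)))"
    unfolding H1_eq_xlnx[OF assms(1,2) refl] x' unfolding x
    unfolding xlnx_mult[OF less_imp_le[OF n] t(1)] xlnx_mult[OF less_imp_le[OF n] t(2)]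
    by (simp add: algebra_simps)
  ultimately show ?thesis
    unfolding t_def[symmetric] by (simp add: right_diff_distrib)
qed

text \<open>
  The fraction of the matchable vertices of the second side that are matched to vertices of the
  first side occupied in the second copy only; it is \<open>0 / 0 = 0\<close> if there are none.
\<close>

definition spread :: "real \<Rightarrow> real \<Rightarrow> real \<Rightarrow> real \<Rightarrow> real \<Rightarrow> real" where
  "spread \<alpha> \<beta> \<gamma> \<delta> \<epsilon> = (\<alpha> - \<gamma>) / (1 - \<beta> - \<gamma> - \<epsilon>)"

text \<open>The nested choices telescope: terms such as \<open>xlnx (1 - \<alpha>)\<close> and
  \<open>xlnx (1 - \<gamma>)\<close> cancel, leaving entropies of the side marginals and of the edge
  law. One \<open>H1\<close> is kept because the cell form and the continuous extension expand it
  differently.\<close>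

lemma f_fun_eq_xlnx_H1:
  assumes z: "(\<gamma>, \<delta>, \<epsilon>) \<in> region \<alpha> \<beta>"
  shows "f_fun 6 1 \<alpha> \<beta> \<gamma> \<delta> \<epsilon> =
     5 * (xlnx \<gamma> + 2 * xlnx (\<alpha> - \<gamma>) + xlnx (1 - 2 * \<alpha> + \<gamma>))
     + 5 * (xlnx \<delta> + 2 * xlnx (\<beta> - \<delta>) + xlnx (1 - 2 * \<beta> + \<delta>))
     - 6 * (xlnx \<gamma> + xlnx \<epsilon> + xlnx (\<alpha> - \<gamma> - \<epsilon>) + xlnx (\<beta> - \<delta> - (\<alpha> - \<gamma> - \<epsilon>))
        + xlnx (1 - 2 * \<beta> + \<delta> - \<gamma> - \<epsilon>) + xlnx (\<beta> - \<delta>) + xlnx \<delta>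
        - H1 (\<alpha> - \<gamma>) (1 - \<beta> - \<gamma> - \<epsilon>))"
proof -
  let ?m = "1 - 2 * \<beta> + \<delta> - \<gamma> - \<epsilon>"
  have r: "0 \<le> \<gamma>" "0 \<le> \<delta>" "0 \<le> \<epsilon>" "0 \<le> \<alpha> - \<gamma>" "0 \<le> \<alpha> - \<gamma> - \<epsilon>" "0 \<le> \<beta> - \<delta>" "0 \<le> ?m"
    "0 \<le> \<alpha>" "\<alpha> \<le> 1" "\<gamma> \<le> \<alpha>" "\<alpha> - \<gamma> \<le> 1 - \<alpha>" "0 \<le> \<beta>" "\<beta> \<le> 1" "\<delta> \<le> \<beta>" "\<beta> - \<delta> \<le> 1 - \<beta>"
    "\<gamma> \<le> 1 - 2 * \<beta> + \<delta>" "\<gamma> \<le> 1" "\<epsilon> \<le> 1 - 2 * \<beta> + \<delta> - \<gamma>" "\<alpha> - \<gamma> - \<epsilon> \<le> \<beta> - \<delta>"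
    "\<alpha> - \<gamma> \<le> 1 - \<gamma>" "\<alpha> - \<gamma> \<le> 1 - \<beta> - \<gamma> - \<epsilon>"
    using z by (auto simp: region_def H1_defined_def)
  have h: "H_fun \<alpha> = xlnx 1 - xlnx \<alpha> - xlnx (1 - \<alpha>)"
    "H1 \<gamma> \<alpha> = xlnx \<alpha> - xlnx \<gamma> - xlnx (\<alpha> - \<gamma>)"
    "H1 (\<alpha> - \<gamma>) (1 - \<alpha>) = xlnx (1 - \<alpha>) - xlnx (\<alpha> - \<gamma>) - xlnx (1 - 2 * \<alpha> + \<gamma>)"
    "H_fun \<beta> = xlnx 1 - xlnx \<beta> - xlnx (1 - \<beta>)"
    "H1 \<delta> \<beta> = xlnx \<beta> - xlnx \<delta> - xlnx (\<beta> - \<delta>)"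
    "H1 (\<beta> - \<delta>) (1 - \<beta>) = xlnx (1 - \<beta>) - xlnx (\<beta> - \<delta>) - xlnx (1 - 2 * \<beta> + \<delta>)"
    "H1 \<gamma> (1 - 2 * \<beta> + \<delta>) = xlnx (1 - 2 * \<beta> + \<delta>) - xlnx \<gamma> - xlnx (1 - 2 * \<beta> + \<delta> - \<gamma>)"
    "H_fun \<gamma> = xlnx 1 - xlnx \<gamma> - xlnx (1 - \<gamma>)"
    "H1 \<epsilon> (1 - 2 * \<beta> + \<delta> - \<gamma>) = xlnx (1 - 2 * \<beta> + \<delta> - \<gamma>) - xlnx \<epsilon> - xlnx ?m"
    "H1 (\<alpha> - \<gamma> - \<epsilon>) (\<beta> - \<delta>) =
      xlnx (\<beta> - \<delta>) - xlnx (\<alpha> - \<gamma> - \<epsilon>) - xlnx (\<beta> - \<delta> - (\<alpha> - \<gamma> - \<epsilon>))"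
    "H1 (\<alpha> - \<gamma>) (1 - \<gamma>) = xlnx (1 - \<gamma>) - xlnx (\<alpha> - \<gamma>) - xlnx (1 - \<alpha>)"
    unfolding H_fun_def by (rule H1_eq_xlnx; use r in simp)+
  show ?thesis
    unfolding f_fun_def h by simp
qed

text \<open>The nine terms of the last bracket are the nine admissible cells of a pair of spin pairs
  on an edge. \<open>u\<close> and \<open>v\<close> count first-side vertices occupied in the second
  copy only, matched to second-side vertices that are empty in both copies, respectively occupied in
  the first copy only.\<close>

lemma f_fun_eq_xlnx:
  assumes z: "(\<gamma>, \<delta>, \<epsilon>) \<in> region \<alpha> \<beta>"
  defines "u \<equiv> (1 - 2 * \<beta> + \<delta> - \<gamma> - \<epsilon>) * spread \<alpha> \<beta> \<gamma> \<delta> \<epsilon>"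
    and "v \<equiv> (\<beta> - \<delta>) * spread \<alpha> \<beta> \<gamma> \<delta> \<epsilon>"
  shows "f_fun 6 1 \<alpha> \<beta> \<gamma> \<delta> \<epsilon> =
     5 * (xlnx \<gamma> + 2 * xlnx (\<alpha> - \<gamma>) + xlnx (1 - 2 * \<alpha> + \<gamma>))
     + 5 * (xlnx \<delta> + 2 * xlnx (\<beta> - \<delta>) + xlnx (1 - 2 * \<beta> + \<delta>))
     - 6 * (xlnx \<gamma> + xlnx \<epsilon> + xlnx (\<alpha> - \<gamma> - \<epsilon>) + xlnx u + xlnx v
        + xlnx (1 - 2 * \<beta> + \<delta> - \<gamma> - \<epsilon> - u) + xlnx (\<beta> - \<delta> - (\<alpha> - \<gamma> - \<epsilon>))
        + xlnx (\<beta> - \<delta> - v) + xlnx \<delta>)"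
    and "u + v = \<alpha> - \<gamma>"
    and "0 \<le> u" "u \<le> 1 - 2 * \<beta> + \<delta> - \<gamma> - \<epsilon>" "0 \<le> v" "v \<le> \<beta> - \<delta>"
proof -
  let ?m = "1 - 2 * \<beta> + \<delta> - \<gamma> - \<epsilon>"
  have mb: "?m + (\<beta> - \<delta>) = 1 - \<beta> - \<gamma> - \<epsilon>" by simp
  have r: "0 \<le> \<alpha> - \<gamma>" "0 \<le> \<beta> - \<delta>" "0 \<le> ?m" "\<alpha> - \<gamma> \<le> 1 - \<beta> - \<gamma> - \<epsilon>"
    using z by (auto simp: region_def H1_defined_def)
  have split: "xlnx u + xlnx (?m - u) + xlnx v + xlnx (\<beta> - \<delta> - v)
      = xlnx ?m + xlnx (\<beta> - \<delta>) - H1 (\<alpha> - \<gamma>) (1 - \<beta> - \<gamma> - \<epsilon>)"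
    using H1_split[of "\<alpha> - \<gamma>" ?m "\<beta> - \<delta>"] r unfolding mb u_def v_def spread_def by simp
  show "f_fun 6 1 \<alpha> \<beta> \<gamma> \<delta> \<epsilon> =
     5 * (xlnx \<gamma> + 2 * xlnx (\<alpha> - \<gamma>) + xlnx (1 - 2 * \<alpha> + \<gamma>))
     + 5 * (xlnx \<delta> + 2 * xlnx (\<beta> - \<delta>) + xlnx (1 - 2 * \<beta> + \<delta>))
     - 6 * (xlnx \<gamma> + xlnx \<epsilon> + xlnx (\<alpha> - \<gamma> - \<epsilon>) + xlnx u + xlnx v
        + xlnx (1 - 2 * \<beta> + \<delta> - \<gamma> - \<epsilon> - u) + xlnx (\<beta> - \<delta> - (\<alpha> - \<gamma> - \<epsilon>))
        + xlnx (\<beta> - \<delta> - v) + xlnx \<delta>)"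
    using split
    unfolding f_fun_eq_xlnx_H1[OF z] by simp
  show "u + v = \<alpha> - \<gamma>"
  proof (cases "1 - \<beta> - \<gamma> - \<epsilon> = 0")
    case True
    with r show ?thesis by (auto simp: u_def v_def spread_def)
  next
    case False
    have "u + v = (?m + (\<beta> - \<delta>)) * spread \<alpha> \<beta> \<gamma> \<delta> \<epsilon>"
      by (simp add: u_def v_def algebra_simps)
    then show ?thesis using False unfolding mb by (simp add: spread_def)
  qed
  have t: "0 \<le> spread \<alpha> \<beta> \<gamma> \<delta> \<epsilon>" "spread \<alpha> \<beta> \<gamma> \<delta> \<epsilon> \<le> 1"
    using r by (auto simp: spread_def divide_le_eq_1 intro!: divide_nonneg_nonneg)
  show "0 \<le> u" "u \<le> ?m" "0 \<le> v" "v \<le> \<beta> - \<delta>"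
    using r t by (auto simp: u_def v_def intro: mult_nonneg_nonneg mult_left_le)
qed

section \<open>Young's inequality and the bilinear form of one and of two copies\<close>

lemma nonneg_power_eq_1:
  fixes x :: real
  assumes "x ^ n = 1" "0 \<le> x" "0 < n"
  shows "x = 1"
  using assms power_eq_imp_eq_base[of x n 1] by simp

text \<open>Young's inequality for the exponents 6/5 and 6. The gap is
  \<open>(W - e)\<^sup>2\<close> times a polynomial with nonnegative coefficients, which settles the
  equality case too.\<close>

lemma young_sixth:
  fixes e W :: real
  assumes "0 \<le> e" "0 \<le> W"
  shows "6 * (e ^ 5 * W) \<le> 5 * e ^ 6 + W ^ 6"
    and "6 * (e ^ 5 * W) = 5 * e ^ 6 + W ^ 6 \<Longrightarrow> e = W"
proof -
  let ?R = "W ^ 4 + 2 * W ^ 3 * e + 3 * W\<^sup>2 * e\<^sup>2 + 4 * W * e ^ 3 + 5 * e ^ 4"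
  have id: "5 * e ^ 6 + W ^ 6 - 6 * (e ^ 5 * W) = (W - e)\<^sup>2 * ?R"
    by (simp add: eval_nat_numeral algebra_simps)
  have R: "0 \<le> ?R" using assms by (intro add_nonneg_nonneg mult_nonneg_nonneg) auto
  then have "0 \<le> (W - e)\<^sup>2 * ?R" by simp
  with id show "6 * (e ^ 5 * W) \<le> 5 * e ^ 6 + W ^ 6" by linarith
  assume "6 * (e ^ 5 * W) = 5 * e ^ 6 + W ^ 6"
  with id have "W = e \<or> ?R = 0" by auto
  moreover have "W = e" if "?R = 0"
  proof -
    have "0 \<le> W ^ 4" "0 \<le> 2 * W ^ 3 * e" "0 \<le> 3 * W\<^sup>2 * e\<^sup>2" "0 \<le> 4 * W * e ^ 3" "0 \<le> 5 * e ^ 4"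
      using assms by auto
    with that have "W ^ 4 = 0" "e ^ 4 = 0" by linarith+
    then show ?thesis by simp
  qed
  ultimately show "e = W" by auto
qed

text \<open>
  The bound \<open>\<parallel>T g\<parallel>\<^sub>6 \<le> \<parallel>g\<parallel>\<^sub>6\<^sub>/\<^sub>5\<close>, raised to the sixth power, for \<open>g = c\<^sup>5\<close> and \<open>T\<close> the conditional
  expectation across an edge.
\<close>

definition contracts :: "real \<Rightarrow> real \<Rightarrow> real \<Rightarrow> real \<Rightarrow> bool" where
  "contracts \<alpha> \<beta> c\<^sub>0 c\<^sub>1 \<longleftrightarrow>
     (1 - \<alpha>) * (((1 - \<alpha> - \<beta>) * c\<^sub>0 ^ 5 + \<beta> * c\<^sub>1 ^ 5) / (1 - \<alpha>)) ^ 6 + \<alpha> * (c\<^sub>0 ^ 5) ^ 6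
       \<le> ((1 - \<beta>) * c\<^sub>0 ^ 6 + \<beta> * c\<^sub>1 ^ 6) ^ 5"

text \<open>Expectation over the edge law of a function of the first spin times a function of the
  second. There is no (1,1) term, as the ends of an edge are never both occupied.\<close>

definition edge_form :: "real \<Rightarrow> real \<Rightarrow> real \<Rightarrow> real \<Rightarrow> real \<Rightarrow> real \<Rightarrow> real" where
  "edge_form \<alpha> \<beta> e\<^sub>0 e\<^sub>1 c\<^sub>0 c\<^sub>1 =
     (1 - \<alpha> - \<beta>) * (e\<^sub>0 ^ 5 * c\<^sub>0 ^ 5) + \<alpha> * (e\<^sub>1 ^ 5 * c\<^sub>0 ^ 5) + \<beta> * (e\<^sub>0 ^ 5 * c\<^sub>1 ^ 5)"

text \<open>Hoelder duality by hand: \<open>young_sixth\<close> is applied at each first spin to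
  \<open>e\<close> and the conditional expectation of the fifth powers of \<open>c\<close>, which is
  \<open>W\<close> at spin 0 and \<open>c\<^sub>0 ^ 5\<close> at spin 1, where the neighbour must be
  empty. The normalizations and the contraction bound the sum by 5 + 1.\<close>

lemma edge_form_le_1:
  assumes p: "0 < \<alpha>" "0 < \<beta>" "\<alpha> + \<beta> < 1"
    and nn: "0 \<le> e\<^sub>0" "0 \<le> e\<^sub>1" "0 \<le> c\<^sub>0" "0 \<le> c\<^sub>1"
    and e: "(1 - \<alpha>) * e\<^sub>0 ^ 6 + \<alpha> * e\<^sub>1 ^ 6 = 1"
    and c: "(1 - \<beta>) * c\<^sub>0 ^ 6 + \<beta> * c\<^sub>1 ^ 6 = 1"
    and contr: "contracts \<alpha> \<beta> c\<^sub>0 c\<^sub>1"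
  shows "edge_form \<alpha> \<beta> e\<^sub>0 e\<^sub>1 c\<^sub>0 c\<^sub>1 \<le> 1"
    and "edge_form \<alpha> \<beta> e\<^sub>0 e\<^sub>1 c\<^sub>0 c\<^sub>1 = 1 \<Longrightarrow>
      (1 - \<alpha>) * e\<^sub>0 = (1 - \<alpha> - \<beta>) * c\<^sub>0 ^ 5 + \<beta> * c\<^sub>1 ^ 5 \<and> e\<^sub>1 = c\<^sub>0 ^ 5"
proof -
  define W where "W = ((1 - \<alpha> - \<beta>) * c\<^sub>0 ^ 5 + \<beta> * c\<^sub>1 ^ 5) / (1 - \<alpha>)"
  have W: "(1 - \<alpha>) * W = (1 - \<alpha> - \<beta>) * c\<^sub>0 ^ 5 + \<beta> * c\<^sub>1 ^ 5" "0 \<le> W"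
    using p nn by (auto simp: W_def intro!: divide_nonneg_nonneg add_nonneg_nonneg mult_nonneg_nonneg)
  have "edge_form \<alpha> \<beta> e\<^sub>0 e\<^sub>1 c\<^sub>0 c\<^sub>1 = e\<^sub>0 ^ 5 * ((1 - \<alpha> - \<beta>) * c\<^sub>0 ^ 5 + \<beta> * c\<^sub>1 ^ 5) + \<alpha> * (e\<^sub>1 ^ 5 * c\<^sub>0 ^ 5)"
    by (simp add: edge_form_def algebra_simps)
  also have "\<dots> = (1 - \<alpha>) * (e\<^sub>0 ^ 5 * W) + \<alpha> * (e\<^sub>1 ^ 5 * c\<^sub>0 ^ 5)"
    by (simp add: W(1)[symmetric])
  finally have b: "edge_form \<alpha> \<beta> e\<^sub>0 e\<^sub>1 c\<^sub>0 c\<^sub>1 = \<dots>" .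
  have K: "(1 - \<alpha>) * W ^ 6 + \<alpha> * (c\<^sub>0 ^ 5) ^ 6 \<le> 1"
    using contr c by (simp add: contracts_def W_def)
  have y0: "(1 - \<alpha>) * (6 * (e\<^sub>0 ^ 5 * W)) \<le> (1 - \<alpha>) * (5 * e\<^sub>0 ^ 6 + W ^ 6)"
    using p by (intro mult_left_mono young_sixth nn W) auto
  have y1: "\<alpha> * (6 * (e\<^sub>1 ^ 5 * c\<^sub>0 ^ 5)) \<le> \<alpha> * (5 * e\<^sub>1 ^ 6 + (c\<^sub>0 ^ 5) ^ 6)"
    using p nn by (intro mult_left_mono young_sixth) auto
  have s: "(1 - \<alpha>) * (5 * e\<^sub>0 ^ 6 + W ^ 6) + \<alpha> * (5 * e\<^sub>1 ^ 6 + (c\<^sub>0 ^ 5) ^ 6) =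
      5 * ((1 - \<alpha>) * e\<^sub>0 ^ 6 + \<alpha> * e\<^sub>1 ^ 6) + ((1 - \<alpha>) * W ^ 6 + \<alpha> * (c\<^sub>0 ^ 5) ^ 6)"
    by (simp only: algebra_simps)
  show "edge_form \<alpha> \<beta> e\<^sub>0 e\<^sub>1 c\<^sub>0 c\<^sub>1 \<le> 1"
  proof -
    have "6 * edge_form \<alpha> \<beta> e\<^sub>0 e\<^sub>1 c\<^sub>0 c\<^sub>1 \<le> 6"
      using order_trans[OF add_mono[OF y0 y1]] s e K by (simp add: b distrib_left mult.left_commute)
    then show ?thesis by simp
  qed
  assume "edge_form \<alpha> \<beta> e\<^sub>0 e\<^sub>1 c\<^sub>0 c\<^sub>1 = 1"
  then have "(1 - \<alpha>) * (6 * (e\<^sub>0 ^ 5 * W)) + \<alpha> * (6 * (e\<^sub>1 ^ 5 * c\<^sub>0 ^ 5)) = 6"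
    by (simp add: b distrib_left mult.left_commute)
  moreover have "(1 - \<alpha>) * (5 * e\<^sub>0 ^ 6 + W ^ 6) + \<alpha> * (5 * e\<^sub>1 ^ 6 + (c\<^sub>0 ^ 5) ^ 6) \<le> 6"
    using s e K by simp
  moreover have sandwich: "x = x' \<and> y = y'" if "x \<le> x'" "y \<le> y'" "x + y = 6" "x' + y' \<le> 6" for x x' y y' :: real
    using that by linarith
  ultimately have "(1 - \<alpha>) * (6 * (e\<^sub>0 ^ 5 * W)) = (1 - \<alpha>) * (5 * e\<^sub>0 ^ 6 + W ^ 6)"
    "\<alpha> * (6 * (e\<^sub>1 ^ 5 * c\<^sub>0 ^ 5)) = \<alpha> * (5 * e\<^sub>1 ^ 6 + (c\<^sub>0 ^ 5) ^ 6)"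
    using sandwich[OF y0 y1] by blast+
  with p have "6 * (e\<^sub>0 ^ 5 * W) = 5 * e\<^sub>0 ^ 6 + W ^ 6"
    "6 * (e\<^sub>1 ^ 5 * c\<^sub>0 ^ 5) = 5 * e\<^sub>1 ^ 6 + (c\<^sub>0 ^ 5) ^ 6"
    by auto
  then have "e\<^sub>0 = W" "e\<^sub>1 = c\<^sub>0 ^ 5"
    using young_sixth(2) nn W(2) by (metis zero_le_power)+
  with W(1) show "(1 - \<alpha>) * e\<^sub>0 = (1 - \<alpha> - \<beta>) * c\<^sub>0 ^ 5 + \<beta> * c\<^sub>1 ^ 5 \<and> e\<^sub>1 = c\<^sub>0 ^ 5"
    by simp
qed

text \<open>The form Q for two copies, sliced by the edge spins (0,0), (1,0), (0,1) of the first
  copy. Indices count the copies in which a vertex is occupied; the ratios for 01 and 10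
  coincide.\<close>

definition pair_form :: "real \<Rightarrow> real \<Rightarrow> real \<Rightarrow> real \<Rightarrow> real \<Rightarrow> real \<Rightarrow> real \<Rightarrow> real \<Rightarrow> real" where
  "pair_form \<alpha> \<beta> e\<^sub>0 e\<^sub>1 e\<^sub>2 c\<^sub>0 c\<^sub>1 c\<^sub>2 =
     (1 - \<alpha> - \<beta>) * edge_form \<alpha> \<beta> e\<^sub>0 e\<^sub>1 c\<^sub>0 c\<^sub>1
     + \<alpha> * edge_form \<alpha> \<beta> e\<^sub>1 e\<^sub>2 c\<^sub>0 c\<^sub>1
     + \<beta> * edge_form \<alpha> \<beta> e\<^sub>0 e\<^sub>1 c\<^sub>1 c\<^sub>2"

lemma pair_form_le_1:
  assumes p: "0 < \<alpha>" "0 < \<beta>" "\<alpha> + \<beta> < 1"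
    and nn: "0 \<le> e\<^sub>0" "0 \<le> e\<^sub>1" "0 \<le> e\<^sub>2" "0 \<le> c\<^sub>0" "0 \<le> c\<^sub>1" "0 \<le> c\<^sub>2"
    and e: "(1 - \<alpha>) * e\<^sub>0 ^ 6 + \<alpha> * e\<^sub>1 ^ 6 = 1" "(1 - \<alpha>) * e\<^sub>1 ^ 6 + \<alpha> * e\<^sub>2 ^ 6 = 1"
    and c: "(1 - \<beta>) * c\<^sub>0 ^ 6 + \<beta> * c\<^sub>1 ^ 6 = 1" "(1 - \<beta>) * c\<^sub>1 ^ 6 + \<beta> * c\<^sub>2 ^ 6 = 1"
    and contr: "contracts \<alpha> \<beta> c\<^sub>0 c\<^sub>1" "contracts \<alpha> \<beta> c\<^sub>1 c\<^sub>2"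
  shows "pair_form \<alpha> \<beta> e\<^sub>0 e\<^sub>1 e\<^sub>2 c\<^sub>0 c\<^sub>1 c\<^sub>2 \<le> 1"
    and "pair_form \<alpha> \<beta> e\<^sub>0 e\<^sub>1 e\<^sub>2 c\<^sub>0 c\<^sub>1 c\<^sub>2 = 1 \<Longrightarrow>
      e\<^sub>0 = 1 \<and> e\<^sub>1 = 1 \<and> e\<^sub>2 = 1 \<and> c\<^sub>0 = 1 \<and> c\<^sub>1 = 1 \<and> c\<^sub>2 = 1"
proof -
  let ?k = "1 - \<alpha> - \<beta>"
  let ?b1 = "edge_form \<alpha> \<beta> e\<^sub>0 e\<^sub>1 c\<^sub>0 c\<^sub>1" and ?b2 = "edge_form \<alpha> \<beta> e\<^sub>1 e\<^sub>2 c\<^sub>0 c\<^sub>1"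
    and ?b3 = "edge_form \<alpha> \<beta> e\<^sub>0 e\<^sub>1 c\<^sub>1 c\<^sub>2"
  note b1 = edge_form_le_1[OF p nn(1,2,4,5) e(1) c(1) contr(1)]
  note b2 = edge_form_le_1[OF p nn(2,3,4,5) e(2) c(1) contr(1)]
  note b3 = edge_form_le_1[OF p nn(1,2,5,6) e(1) c(2) contr(2)]
  have k: "0 < ?k" using p by simp
  have m: "?k * ?b1 \<le> ?k" "\<alpha> * ?b2 \<le> \<alpha>" "\<beta> * ?b3 \<le> \<beta>"
    using b1(1) b2(1) b3(1) p k by (auto intro: mult_left_le)
  show "pair_form \<alpha> \<beta> e\<^sub>0 e\<^sub>1 e\<^sub>2 c\<^sub>0 c\<^sub>1 c\<^sub>2 \<le> 1"
    using m by (simp add: pair_form_def)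
  assume "pair_form \<alpha> \<beta> e\<^sub>0 e\<^sub>1 e\<^sub>2 c\<^sub>0 c\<^sub>1 c\<^sub>2 = 1"
  then have "?k * ?b1 = ?k" "\<alpha> * ?b2 = \<alpha>"
    using m unfolding pair_form_def by linarith+
  with p k have "?b1 = 1" "?b2 = 1" by auto
  \<comment> \<open>Both slices carry the same \<open>c\<^sub>0\<close>, \<open>c\<^sub>1\<close>,
    so \<open>(e\<^sub>0, e\<^sub>1)\<close> and \<open>(e\<^sub>1, e\<^sub>2)\<close> are the same
    image under the edge operator. Hence \<open>e\<close> is constant, and the normalizations
    propagate the value 1 to everything else.\<close>
  note q = b1(2)[OF this(1)] b2(2)[OF this(2)]
  from q have e0: "(1 - \<alpha>) * e\<^sub>0 = (1 - \<alpha>) * e\<^sub>1" by simp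
  then have "e\<^sub>0 = e\<^sub>1" using p by simp
  moreover from this e(1) have "e\<^sub>1 ^ 6 = 1" by (simp add: algebra_simps)
  then have e1: "e\<^sub>1 = 1" by (rule nonneg_power_eq_1) (use nn in simp_all)
  moreover have e2: "e\<^sub>2 = 1" using q e1 by simp
  moreover have c0: "c\<^sub>0 = 1"
  proof -
    have "c\<^sub>0 ^ 5 = 1" using q e1 by simp
    then show ?thesis by (rule nonneg_power_eq_1) (use nn in simp_all)
  qed
  moreover have c1: "c\<^sub>1 = 1"
  proof -
    have "\<beta> * c\<^sub>1 ^ 6 = \<beta>" using c(1) c0 by (simp add: algebra_simps)
    then have "c\<^sub>1 ^ 6 = 1" using p by simp
    then show ?thesis by (rule nonneg_power_eq_1) (use nn in simp_all)
  qed
  moreover have "c\<^sub>2 = 1"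
  proof -
    have "\<beta> * c\<^sub>2 ^ 6 = \<beta>" using c(2) c1 by (simp add: algebra_simps)
    then have "c\<^sub>2 ^ 6 = 1" using p by simp
    then show ?thesis by (rule nonneg_power_eq_1) (use nn in simp_all)
  qed
  ultimately show "e\<^sub>0 = 1 \<and> e\<^sub>1 = 1 \<and> e\<^sub>2 = 1 \<and> c\<^sub>0 = 1 \<and> c\<^sub>1 = 1 \<and> c\<^sub>2 = 1"
    by simp
qed

section \<open>Reduction to the one-copy contraction\<close>

text \<open>This is 6 x ln (w / x) with w = X (a/A)^(5/6) (b/B)^(5/6), expanded so that sums over
  cells are linear in each logarithm.\<close>

definition gibbs_cell :: "real \<Rightarrow> real \<Rightarrow> real \<Rightarrow> real \<Rightarrow> real \<Rightarrow> real \<Rightarrow> real" where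
  "gibbs_cell x X a A b B = x * (6 * ln X + 5 * ln a - 5 * ln A + 5 * ln b - 5 * ln B - 6 * ln x)"

text \<open>The bounds of \<open>x\<close> by its marginals keep the logarithms genuine: a vanishing
  marginal forces an empty cell, which contributes 0. For \<open>x > 0\<close> this is ln t <= t - 1
  at t = w / x, tight only at t = 1.\<close>

lemma gibbs_cell_le:
  assumes x: "0 \<le> x" "x \<le> a" "x \<le> b" and pos: "0 < X" "0 < A" "0 < B"
    and ec: "0 \<le> e" "0 \<le> c" and a: "A * e ^ 6 = a" and b: "B * c ^ 6 = b"
  shows "gibbs_cell x X a A b B \<le> 6 * (X * (e ^ 5 * c ^ 5)) - 6 * x"
    and "gibbs_cell x X a A b B = 6 * (X * (e ^ 5 * c ^ 5)) - 6 * x \<Longrightarrow> x = X * (e ^ 5 * c ^ 5)"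
proof -
  let ?w = "X * (e ^ 5 * c ^ 5)"
  have "gibbs_cell x X a A b B \<le> 6 * ?w - 6 * x \<and>
    (gibbs_cell x X a A b B = 6 * ?w - 6 * x \<longrightarrow> x = ?w)"
  proof (cases "x = 0")
    case True
    with pos ec show ?thesis by (simp add: gibbs_cell_def)
  next
    case False
    with x have xpos: "0 < x" "0 < a" "0 < b" by auto
    with a b ec have ec': "0 < e" "0 < c"
      by (metis less_eq_real_def mult_zero_right power_zero_numeral less_irrefl)+
    have w: "0 < ?w / x" using pos ec' xpos by simp
    have lnab: "ln a = ln A + 6 * ln e" "ln b = ln B + 6 * ln c"
      using ec' pos by (simp_all add: a[symmetric] b[symmetric] ln_mult ln_realpow)
    have lnw: "ln (?w / x) = ln X + 5 * ln e + 5 * ln c - ln x"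
      using ec' pos xpos by (simp add: ln_mult ln_div ln_realpow)
    have g: "gibbs_cell x X a A b B = 6 * x * ln (?w / x)"
      unfolding gibbs_cell_def lnw lnab by (simp add: algebra_simps)
    have r: "6 * ?w - 6 * x = 6 * x * (?w / x - 1)"
      using xpos by (simp add: field_simps)
    have "ln (?w / x) \<le> ?w / x - 1" using w by (rule ln_le_minus_one)
    then have "gibbs_cell x X a A b B \<le> 6 * ?w - 6 * x"
      unfolding g r using xpos by (intro mult_left_mono) auto
    moreover have "x = ?w" if "gibbs_cell x X a A b B = 6 * ?w - 6 * x"
    proof -
      from that have "ln (?w / x) = ?w / x - 1"
        unfolding g r using xpos by simp
      with w have "?w / x = 1" by (rule ln_eq_minus_one)
      then show ?thesis using xpos by simp
    qed
    ultimately show ?thesis by blast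
  qed
  then show "gibbs_cell x X a A b B \<le> 6 * ?w - 6 * x"
    "gibbs_cell x X a A b B = 6 * ?w - 6 * x \<Longrightarrow> x = ?w" by auto
qed

definition product_exponent :: "real \<Rightarrow> real \<Rightarrow> real" where
  "product_exponent \<alpha> \<beta> = 10 * (1 - \<alpha>) * ln (1 - \<alpha>) + 10 * (1 - \<beta>) * ln (1 - \<beta>)
     - 2 * \<alpha> * ln \<alpha> - 2 * \<beta> * ln \<beta> - 12 * (1 - \<alpha> - \<beta>) * ln (1 - \<alpha> - \<beta>)"

text \<open>All logarithms become independent variables, leaving a polynomial identity. The
  reference logarithms \<open>la\<close>, \<open>lb\<close>, \<open>lk\<close>, \<open>la'\<close>,
  \<open>lb'\<close> collect coefficients depending only on the prescribed one-copy densities, so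
  the constant is free of \<gamma>, \<delta>, \<epsilon> and \<open>u\<close>.\<close>

lemma gibbs_cells_identity:
  fixes \<alpha> \<beta> \<gamma> \<delta> \<epsilon> u la lb lk la' lb' :: real
  defines "w \<equiv> \<alpha> - \<gamma> - \<epsilon>" and "v \<equiv> \<alpha> - \<gamma> - u"
  defines "p \<equiv> 1 - 2 * \<beta> + \<delta> - \<gamma> - \<epsilon> - u" and "q \<equiv> \<beta> - \<delta> - w" and "r \<equiv> \<beta> - \<delta> - v"
  shows
    "\<gamma> * (6 * (2 * la) + 5 * a2 - 5 * (2 * la) + 5 * b0 - 5 * (2 * lb') - 6 * l1)
   + \<epsilon> * (6 * (la + lk) + 5 * a1 - 5 * (la + la') + 5 * b0 - 5 * (2 * lb') - 6 * l2)
   + w * (6 * (la + lb) + 5 * a1 - 5 * (la + la') + 5 * b1 - 5 * (lb + lb') - 6 * l3)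
   + u * (6 * (la + lk) + 5 * a1 - 5 * (la + la') + 5 * b0 - 5 * (2 * lb') - 6 * l4)
   + v * (6 * (la + lb) + 5 * a1 - 5 * (la + la') + 5 * b1 - 5 * (lb + lb') - 6 * l5)
   + p * (6 * (2 * lk) + 5 * a0 - 5 * (2 * la') + 5 * b0 - 5 * (2 * lb') - 6 * l6)
   + q * (6 * (lb + lk) + 5 * a0 - 5 * (2 * la') + 5 * b1 - 5 * (lb + lb') - 6 * l7)
   + r * (6 * (lb + lk) + 5 * a0 - 5 * (2 * la') + 5 * b1 - 5 * (lb + lb') - 6 * l8)
   + \<delta> * (6 * (2 * lb) + 5 * a0 - 5 * (2 * la') + 5 * b2 - 5 * (2 * lb) - 6 * l9)
   = 5 * (\<gamma> * a2 + 2 * ((\<alpha> - \<gamma>) * a1) + (1 - 2 * \<alpha> + \<gamma>) * a0)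
     + 5 * (\<delta> * b2 + 2 * ((\<beta> - \<delta>) * b1) + (1 - 2 * \<beta> + \<delta>) * b0)
     - 6 * (\<gamma> * l1 + \<epsilon> * l2 + w * l3 + u * l4 + v * l5 + p * l6 + q * l7 + r * l8 + \<delta> * l9)
     - (10 * (1 - \<alpha>) * la' + 10 * (1 - \<beta>) * lb'
     - 2 * \<alpha> * la - 2 * \<beta> * lb - 12 * (1 - \<alpha> - \<beta>) * lk)"
  unfolding w_def v_def p_def q_def r_def by (simp add: algebra_simps)

lemma gibbs_cells_sum:
  assumes p: "0 < \<alpha>" "0 < \<beta>" "\<alpha> + \<beta> < 1"
    and z: "(\<gamma>, \<delta>, \<epsilon>) \<in> region \<alpha> \<beta>"
  defines "u \<equiv> (1 - 2 * \<beta> + \<delta> - \<gamma> - \<epsilon>) * spread \<alpha> \<beta> \<gamma> \<delta> \<epsilon>"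
    and "k \<equiv> 1 - \<alpha> - \<beta>"
    and "a\<^sub>2 \<equiv> \<gamma>" and "a\<^sub>1 \<equiv> \<alpha> - \<gamma>" and "a\<^sub>0 \<equiv> 1 - 2 * \<alpha> + \<gamma>"
    and "b\<^sub>2 \<equiv> \<delta>" and "b\<^sub>1 \<equiv> \<beta> - \<delta>" and "b\<^sub>0 \<equiv> 1 - 2 * \<beta> + \<delta>"
    and "A\<^sub>2 \<equiv> \<alpha> * \<alpha>" and "A\<^sub>1 \<equiv> \<alpha> * (1 - \<alpha>)" and "A\<^sub>0 \<equiv> (1 - \<alpha>) * (1 - \<alpha>)"
    and "B\<^sub>2 \<equiv> \<beta> * \<beta>" and "B\<^sub>1 \<equiv> \<beta> * (1 - \<beta>)" and "B\<^sub>0 \<equiv> (1 - \<beta>) * (1 - \<beta>)"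
  shows
    "gibbs_cell \<gamma> (\<alpha> * \<alpha>) a\<^sub>2 A\<^sub>2 b\<^sub>0 B\<^sub>0
   + gibbs_cell \<epsilon> (\<alpha> * k) a\<^sub>1 A\<^sub>1 b\<^sub>0 B\<^sub>0
   + gibbs_cell (\<alpha> - \<gamma> - \<epsilon>) (\<alpha> * \<beta>) a\<^sub>1 A\<^sub>1 b\<^sub>1 B\<^sub>1
   + gibbs_cell u (\<alpha> * k) a\<^sub>1 A\<^sub>1 b\<^sub>0 B\<^sub>0
   + gibbs_cell (\<alpha> - \<gamma> - u) (\<alpha> * \<beta>) a\<^sub>1 A\<^sub>1 b\<^sub>1 B\<^sub>1
   + gibbs_cell (1 - 2 * \<beta> + \<delta> - \<gamma> - \<epsilon> - u) (k * k) a\<^sub>0 A\<^sub>0 b\<^sub>0 B\<^sub>0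
   + gibbs_cell (\<beta> - \<delta> - (\<alpha> - \<gamma> - \<epsilon>)) (\<beta> * k) a\<^sub>0 A\<^sub>0 b\<^sub>1 B\<^sub>1
   + gibbs_cell (\<beta> - \<delta> - (\<alpha> - \<gamma> - u)) (\<beta> * k) a\<^sub>0 A\<^sub>0 b\<^sub>1 B\<^sub>1
   + gibbs_cell \<delta> (\<beta> * \<beta>) a\<^sub>0 A\<^sub>0 b\<^sub>2 B\<^sub>2
   = f_fun 6 1 \<alpha> \<beta> \<gamma> \<delta> \<epsilon> - product_exponent \<alpha> \<beta>"
proof -
  have lns: "ln (\<alpha> * \<alpha>) = 2 * ln \<alpha>" "ln (\<alpha> * k) = ln \<alpha> + ln k" "ln (\<alpha> * \<beta>) = ln \<alpha> + ln \<beta>"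
    "ln (k * k) = 2 * ln k" "ln (\<beta> * k) = ln \<beta> + ln k" "ln (\<beta> * \<beta>) = 2 * ln \<beta>"
    "ln (\<alpha> * (1 - \<alpha>)) = ln \<alpha> + ln (1 - \<alpha>)" "ln (\<beta> * (1 - \<beta>)) = ln \<beta> + ln (1 - \<beta>)"
    "ln ((1 - \<alpha>) * (1 - \<alpha>)) = 2 * ln (1 - \<alpha>)" "ln ((1 - \<beta>) * (1 - \<beta>)) = 2 * ln (1 - \<beta>)"
    using p by (simp_all add: ln_mult k_def)
  note f = f_fun_eq_xlnx[OF z]
  have v: "(\<beta> - \<delta>) * spread \<alpha> \<beta> \<gamma> \<delta> \<epsilon> = \<alpha> - \<gamma> - u"
    using f(2) by (simp add: u_def)
  show ?thesis
    unfolding gibbs_cell_def A\<^sub>2_def A\<^sub>1_def A\<^sub>0_def B\<^sub>2_def B\<^sub>1_def B\<^sub>0_def lns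
    unfolding gibbs_cells_identity f(1) product_exponent_def u_def[symmetric] v
    unfolding xlnx_def a\<^sub>2_def a\<^sub>1_def a\<^sub>0_def b\<^sub>2_def b\<^sub>1_def b\<^sub>0_def k_def ..
qed

lemma product_point_in_region:
  assumes "0 < \<alpha>" "0 < \<beta>" "\<alpha> + \<beta> < 1"
  shows "(\<alpha>\<^sup>2, \<beta>\<^sup>2, \<alpha> * (1 - \<alpha> - \<beta>)) \<in> region \<alpha> \<beta>"
proof -
  have nn: "0 \<le> \<alpha> * \<alpha>" "0 \<le> \<beta> * \<beta>" "0 \<le> \<alpha> * \<beta>" "0 \<le> \<alpha> * (1 - \<alpha> - \<beta>)" "0 \<le> \<beta> * (1 - \<alpha> - \<beta>)"
    "0 \<le> (1 - \<alpha> - \<beta>) * (1 - \<alpha> - \<beta>)"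
    "0 \<le> (1 - \<alpha>) * (1 - \<alpha>)" "0 \<le> (1 - \<beta>) * (1 - \<beta>)" "0 \<le> (1 - \<alpha>) * (1 + \<alpha>)"
    using assms by auto
  show ?thesis
    using nn assms unfolding region_def H1_defined_def
    by (simp add: power2_eq_square algebra_simps)
qed

text \<open>At this point every cell and every marginal equals its reference value, so each
  \<open>gibbs_cell\<close> vanishes and the decomposition itself yields the value of f.\<close>

lemma f_fun_product_point:
  assumes p: "0 < \<alpha>" "0 < \<beta>" "\<alpha> + \<beta> < 1"
  shows "f_fun 6 1 \<alpha> \<beta> (\<alpha>\<^sup>2) (\<beta>\<^sup>2) (\<alpha> * (1 - \<alpha> - \<beta>)) = product_exponent \<alpha> \<beta>"
proof -
  let ?k = "1 - \<alpha> - \<beta>"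
  have n: "1 - \<beta> - \<alpha>\<^sup>2 - \<alpha> * ?k = (1 - \<alpha>) * (1 - \<beta>)"
    "1 - 2 * \<beta> + \<beta>\<^sup>2 - \<alpha>\<^sup>2 - \<alpha> * ?k = ?k * (1 - \<beta>)"
    "\<alpha> - \<alpha>\<^sup>2 = \<alpha> * (1 - \<alpha>)" "\<beta> - \<beta>\<^sup>2 = \<beta> * (1 - \<beta>)"
    "1 - 2 * \<alpha> + \<alpha>\<^sup>2 = (1 - \<alpha>) * (1 - \<alpha>)" "1 - 2 * \<beta> + \<beta>\<^sup>2 = (1 - \<beta>) * (1 - \<beta>)"
    by (simp_all add: power2_eq_square algebra_simps)
  have "spread \<alpha> \<beta> (\<alpha>\<^sup>2) (\<beta>\<^sup>2) (\<alpha> * ?k) = \<alpha> / (1 - \<beta>)"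
    using p unfolding spread_def n by simp
  then have u: "(?k * (1 - \<beta>)) * spread \<alpha> \<beta> (\<alpha>\<^sup>2) (\<beta>\<^sup>2) (\<alpha> * ?k) = \<alpha> * ?k"
    using p by simp
  have m: "\<alpha> * (1 - \<alpha>) - \<alpha> * ?k = \<alpha> * \<beta>" "?k * (1 - \<beta>) - \<alpha> * ?k = ?k * ?k"
    "\<beta> * (1 - \<beta>) - \<alpha> * \<beta> = \<beta> * ?k"
    by (simp_all add: algebra_simps)
  have z: "gibbs_cell x x a a b b = 0" for x a b by (simp add: gibbs_cell_def)
  show ?thesis
    using gibbs_cells_sum[OF p product_point_in_region[OF p]]
    unfolding n(2) u unfolding n m unfolding power2_eq_square z by simp
qed

lemma pair_form_expand:
  "pair_form \<alpha> \<beta> e\<^sub>0 e\<^sub>1 e\<^sub>2 c\<^sub>0 c\<^sub>1 c\<^sub>2 =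
     (\<alpha> * \<alpha>) * (e\<^sub>2 ^ 5 * c\<^sub>0 ^ 5)
   + (\<alpha> * (1 - \<alpha> - \<beta>)) * (e\<^sub>1 ^ 5 * c\<^sub>0 ^ 5)
   + (\<alpha> * \<beta>) * (e\<^sub>1 ^ 5 * c\<^sub>1 ^ 5)
   + (\<alpha> * (1 - \<alpha> - \<beta>)) * (e\<^sub>1 ^ 5 * c\<^sub>0 ^ 5)
   + (\<alpha> * \<beta>) * (e\<^sub>1 ^ 5 * c\<^sub>1 ^ 5)
   + ((1 - \<alpha> - \<beta>) * (1 - \<alpha> - \<beta>)) * (e\<^sub>0 ^ 5 * c\<^sub>0 ^ 5)
   + (\<beta> * (1 - \<alpha> - \<beta>)) * (e\<^sub>0 ^ 5 * c\<^sub>1 ^ 5)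
   + (\<beta> * (1 - \<alpha> - \<beta>)) * (e\<^sub>0 ^ 5 * c\<^sub>1 ^ 5)
   + (\<beta> * \<beta>) * (e\<^sub>0 ^ 5 * c\<^sub>2 ^ 5)"
proof -
  have ring: "k * (k * t00 + \<alpha> * t10 + \<beta> * t01) + \<alpha> * (k * t10 + \<alpha> * t20 + \<beta> * t11)
      + \<beta> * (k * t01 + \<alpha> * t11 + \<beta> * t02)
    = (\<alpha> * \<alpha>) * t20 + (\<alpha> * k) * t10 + (\<alpha> * \<beta>) * t11 + (\<alpha> * k) * t10 + (\<alpha> * \<beta>) * t11
      + (k * k) * t00 + (\<beta> * k) * t01 + (\<beta> * k) * t01 + (\<beta> * \<beta>) * t02"
    for k t00 t10 t01 t20 t11 t02 :: real
    by (simp add: algebra_simps)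
  show ?thesis
    unfolding pair_form_def edge_form_def by (rule ring)
qed

section \<open>Comparison of an arbitrary point with the product point\<close>

definition density_root :: "real \<Rightarrow> real \<Rightarrow> real" where
  "density_root x X = root 6 (x / X)"

lemma density_root:
  assumes "0 \<le> x" "0 < X"
  shows "0 \<le> density_root x X" "X * density_root x X ^ 6 = x"
  using assms by (simp_all add: density_root_def real_root_pow_pos2)

text \<open>A point doing at least as well as the product point makes every inequality in the chain
  tight. Q = 1 forces all marginal ratios to be 1 and so fixes \<gamma> and \<delta>. The marginals
  do not determine \<epsilon>; it is read off from equality in its own cell, the only one the
  \<open>sandwich\<close> step extracts.\<close>

lemma f_fun_le_product_point:
  assumes p: "0 < \<alpha>" "0 < \<beta>" "\<alpha> + \<beta> < 1"
    and z: "(\<gamma>, \<delta>, \<epsilon>) \<in> region \<alpha> \<beta>"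
    and contr:
      "contracts \<alpha> \<beta> (density_root (1 - 2 * \<beta> + \<delta>) ((1 - \<beta>) * (1 - \<beta>)))
         (density_root (\<beta> - \<delta>) (\<beta> * (1 - \<beta>)))"
      "contracts \<alpha> \<beta> (density_root (\<beta> - \<delta>) (\<beta> * (1 - \<beta>))) (density_root \<delta> (\<beta> * \<beta>))"
    and max: "f_fun 6 1 \<alpha> \<beta> (\<alpha>\<^sup>2) (\<beta>\<^sup>2) (\<alpha> * (1 - \<alpha> - \<beta>)) \<le> f_fun 6 1 \<alpha> \<beta> \<gamma> \<delta> \<epsilon>"
  shows "\<gamma> = \<alpha>\<^sup>2 \<and> \<delta> = \<beta>\<^sup>2 \<and> \<epsilon> = \<alpha> * (1 - \<alpha> - \<beta>)"
proof -
  define k where "k = 1 - \<alpha> - \<beta>"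
  define u where "u = (1 - 2 * \<beta> + \<delta> - \<gamma> - \<epsilon>) * spread \<alpha> \<beta> \<gamma> \<delta> \<epsilon>"
  define e\<^sub>0 where "e\<^sub>0 = density_root (1 - 2 * \<alpha> + \<gamma>) ((1 - \<alpha>) * (1 - \<alpha>))"
  define e\<^sub>1 where "e\<^sub>1 = density_root (\<alpha> - \<gamma>) (\<alpha> * (1 - \<alpha>))"
  define e\<^sub>2 where "e\<^sub>2 = density_root \<gamma> (\<alpha> * \<alpha>)"
  define c\<^sub>0 where "c\<^sub>0 = density_root (1 - 2 * \<beta> + \<delta>) ((1 - \<beta>) * (1 - \<beta>))"
  define c\<^sub>1 where "c\<^sub>1 = density_root (\<beta> - \<delta>) (\<beta> * (1 - \<beta>))"
  define c\<^sub>2 where "c\<^sub>2 = density_root \<delta> (\<beta> * \<beta>)"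
  have r: "0 \<le> \<gamma>" "0 \<le> \<delta>" "0 \<le> \<epsilon>" "0 \<le> \<alpha> - \<gamma>" "0 \<le> \<beta> - \<delta>" "0 \<le> 1 - 2 * \<alpha> + \<gamma>"
    "0 \<le> 1 - 2 * \<beta> + \<delta>" "0 \<le> \<alpha> - \<gamma> - \<epsilon>" "0 \<le> \<beta> - \<delta> - (\<alpha> - \<gamma> - \<epsilon>)"
    using z by (auto simp: region_def H1_defined_def)
  have pos: "0 < \<alpha> * \<alpha>" "0 < \<alpha> * (1 - \<alpha>)" "0 < (1 - \<alpha>) * (1 - \<alpha>)"
    "0 < \<beta> * \<beta>" "0 < \<beta> * (1 - \<beta>)" "0 < (1 - \<beta>) * (1 - \<beta>)"
    "0 < \<alpha> * k" "0 < \<alpha> * \<beta>" "0 < k * k" "0 < \<beta> * k"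
    using p by (auto simp: k_def intro!: mult_pos_pos)
  note f = f_fun_eq_xlnx[OF z, folded u_def]
  have v: "(\<beta> - \<delta>) * spread \<alpha> \<beta> \<gamma> \<delta> \<epsilon> = \<alpha> - \<gamma> - u"
    using f(2) by simp
  have cells: "0 \<le> u" "0 \<le> \<alpha> - \<gamma> - u" "0 \<le> 1 - 2 * \<beta> + \<delta> - \<gamma> - \<epsilon> - u"
    "0 \<le> \<beta> - \<delta> - (\<alpha> - \<gamma> - u)"
    using f(3-6) unfolding v by linarith+
  have e: "0 \<le> e\<^sub>0" "0 \<le> e\<^sub>1" "0 \<le> e\<^sub>2" "(1 - \<alpha>) * (1 - \<alpha>) * e\<^sub>0 ^ 6 = 1 - 2 * \<alpha> + \<gamma>"
    "\<alpha> * (1 - \<alpha>) * e\<^sub>1 ^ 6 = \<alpha> - \<gamma>" "\<alpha> * \<alpha> * e\<^sub>2 ^ 6 = \<gamma>"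
    using density_root r pos unfolding e\<^sub>0_def e\<^sub>1_def e\<^sub>2_def by blast+
  have c: "0 \<le> c\<^sub>0" "0 \<le> c\<^sub>1" "0 \<le> c\<^sub>2" "(1 - \<beta>) * (1 - \<beta>) * c\<^sub>0 ^ 6 = 1 - 2 * \<beta> + \<delta>"
    "\<beta> * (1 - \<beta>) * c\<^sub>1 ^ 6 = \<beta> - \<delta>" "\<beta> * \<beta> * c\<^sub>2 ^ 6 = \<delta>"
    using density_root r pos unfolding c\<^sub>0_def c\<^sub>1_def c\<^sub>2_def by blast+
  \<comment> \<open>The two slices of the normalization, for first-copy spin 0 and 1, cleared of the
    factors \<open>1 - t\<close> and \<open>t\<close>.\<close>
  have marg: "(1 - t) * x + t * y = 1" "(1 - t) * y + t * w = 1"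
    if "0 < t" "t < 1" "(1 - t) * (1 - t) * x = 1 - 2 * t + s" "t * (1 - t) * y = t - s" "t * t * w = s"
    for t x y w s :: real
  proof -
    have "(1 - t) * ((1 - t) * x + t * y) = (1 - t) * 1" using that(3,4) by (simp add: algebra_simps)
    then show "(1 - t) * x + t * y = 1" using that by simp
    have "t * ((1 - t) * y + t * w) = t * 1" using that(4,5) by (simp add: algebra_simps)
    then show "(1 - t) * y + t * w = 1" using that by simp
  qed
  have lt: "\<alpha> < 1" "\<beta> < 1" using p by auto
  note em = marg[OF p(1) lt(1) e(4-6)] and cm = marg[OF p(2) lt(2) c(4-6)]
  note Q = pair_form_le_1[OF p e(1-3) c(1-3) em cm contr[folded c\<^sub>0_def c\<^sub>1_def c\<^sub>2_def]]
  note cell = gibbs_cell_le(1)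
  note bounds =
    cell[OF r(1) _ _ pos(1) pos(1) pos(6) e(3) c(1) e(6) c(4)]
    cell[OF r(3) _ _ pos(7) pos(2) pos(6) e(2) c(1) e(5) c(4)]
    cell[OF r(8) _ _ pos(8) pos(2) pos(5) e(2) c(2) e(5) c(5)]
    cell[OF cells(1) _ _ pos(7) pos(2) pos(6) e(2) c(1) e(5) c(4)]
    cell[OF cells(2) _ _ pos(8) pos(2) pos(5) e(2) c(2) e(5) c(5)]
    cell[OF cells(3) _ _ pos(9) pos(3) pos(6) e(1) c(1) e(4) c(4)]
    cell[OF r(9) _ _ pos(10) pos(3) pos(5) e(1) c(2) e(4) c(5)]
    cell[OF cells(4) _ _ pos(10) pos(3) pos(5) e(1) c(2) e(4) c(5)]
    cell[OF r(2) _ _ pos(4) pos(3) pos(4) e(1) c(3) e(4) c(6)]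
  have sandwich: "Q = 1 \<and> x2 = y2"
    if "x1 \<le> y1" "x2 \<le> y2" "x3 \<le> y3" "x4 \<le> y4" "x5 \<le> y5" "x6 \<le> y6" "x7 \<le> y7" "x8 \<le> y8" "x9 \<le> y9"
      "y1 + y2 + y3 + y4 + y5 + y6 + y7 + y8 + y9 = 6 * Q - 6" "Q \<le> 1"
      "x1 + x2 + x3 + x4 + x5 + x6 + x7 + x8 + x9 = F" "0 \<le> F"
    for x1 x2 x3 x4 x5 x6 x7 x8 x9 y1 y2 y3 y4 y5 y6 y7 y8 y9 F Q :: real
    using that by linarith
  have F: "0 \<le> f_fun 6 1 \<alpha> \<beta> \<gamma> \<delta> \<epsilon> - product_exponent \<alpha> \<beta>"
    using max unfolding f_fun_product_point[OF p] by simp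
  have "pair_form \<alpha> \<beta> e\<^sub>0 e\<^sub>1 e\<^sub>2 c\<^sub>0 c\<^sub>1 c\<^sub>2 = 1 \<and>
    gibbs_cell \<epsilon> (\<alpha> * k) (\<alpha> - \<gamma>) (\<alpha> * (1 - \<alpha>)) (1 - 2 * \<beta> + \<delta>) ((1 - \<beta>) * (1 - \<beta>))
      = 6 * ((\<alpha> * k) * (e\<^sub>1 ^ 5 * c\<^sub>0 ^ 5)) - 6 * \<epsilon>"
  proof (rule sandwich[OF bounds _ Q(1) gibbs_cells_sum[OF p z, folded u_def k_def] F])
  qed (use r cells in \<open>linarith | simp add: pair_form_expand k_def[symmetric]\<close>)+
  then have Q1: "pair_form \<alpha> \<beta> e\<^sub>0 e\<^sub>1 e\<^sub>2 c\<^sub>0 c\<^sub>1 c\<^sub>2 = 1"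
    and eps: "gibbs_cell \<epsilon> (\<alpha> * k) (\<alpha> - \<gamma>) (\<alpha> * (1 - \<alpha>)) (1 - 2 * \<beta> + \<delta>) ((1 - \<beta>) * (1 - \<beta>))
      = 6 * ((\<alpha> * k) * (e\<^sub>1 ^ 5 * c\<^sub>0 ^ 5)) - 6 * \<epsilon>" by auto
  have "\<epsilon> \<le> \<alpha> - \<gamma>" "\<epsilon> \<le> 1 - 2 * \<beta> + \<delta>" using r cells by linarith+
  then have "\<epsilon> = (\<alpha> * k) * (e\<^sub>1 ^ 5 * c\<^sub>0 ^ 5)"
    using gibbs_cell_le(2)[OF r(3) _ _ pos(7) pos(2) pos(6) e(2) c(1) e(5) c(4) eps] by simp
  with Q(2)[OF Q1] e(6) c(6) show ?thesis
    by (simp add: k_def power2_eq_square)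
qed

section \<open>One-variable profiles\<close>

locale edge_profile =
  fixes k b m K :: real
  assumes pos: "0 < k" "0 < b" "0 < m" "0 < K"
begin

text \<open>\<open>slope\<close> has the sign of the derivative of \<open>profile\<close>; it is nonnegative iff \<open>log_slope\<close> is at
  least \<open>ln K\<close>; and \<open>turn\<close> has the sign of the derivative of \<open>log_slope\<close>.\<close>

definition profile :: "real \<Rightarrow> real" where
  "profile s = ln ((k + b * s ^ 5) ^ 6 + K) - 5 * ln (m + b * s ^ 6)"

definition slope :: "real \<Rightarrow> real" where
  "slope s = (k + b * s ^ 5) ^ 5 * (m - k * s) - K * s"

definition log_slope :: "real \<Rightarrow> real" where
  "log_slope s = 5 * ln (k + b * s ^ 5) + ln (m - k * s) - ln s"

definition turn :: "real \<Rightarrow> real" where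
  "turn s = b * s ^ 5 * (24 * m - 25 * k * s) - k * m"

lemma P_pos: "0 \<le> s \<Longrightarrow> 0 < k + b * s ^ 5"
  using pos by (intro add_pos_nonneg) auto

lemma D_pos: "0 \<le> s \<Longrightarrow> 0 < m + b * s ^ 6"
  using pos by (intro add_pos_nonneg) auto

lemma deriv_profile:
  assumes "0 \<le> s"
  obtains w where "0 \<le> w" "(profile has_real_derivative w * slope s) (at s)"
proof -
  define P where "P = k + b * s ^ 5"
  define D where "D = m + b * s ^ 6"
  have P: "0 < P ^ 6 + K" and D: "0 < D"
    using P_pos[OF assms] D_pos[OF assms] pos by (auto simp: P_def D_def intro!: add_pos_pos)
  have "(profile has_real_derivative
      (6 * P ^ 5 * (b * (5 * s ^ 4))) / (P ^ 6 + K) - 5 * ((b * (6 * s ^ 5)) / D)) (at s)"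
    unfolding profile_def[abs_def]
    using P D by (auto intro!: derivative_eq_intros simp: P_def D_def mult.commute mult.left_commute)
  \<comment> \<open>The numerator of the derivative collapses because the terms in
    \<open>s ^ 6\<close> cancel in \<open>D - s * P\<close>.\<close>
  moreover have "P ^ 5 * D - s * (P ^ 6 + K) = slope s"
  proof -
    have R: "m - k * s = D - s * P" by (simp add: P_def D_def eval_nat_numeral algebra_simps)
    show ?thesis
      unfolding slope_def P_def[symmetric] R by (simp add: eval_nat_numeral algebra_simps)
  qed
  then have "(6 * P ^ 5 * (b * (5 * s ^ 4))) / (P ^ 6 + K) - 5 * ((b * (6 * s ^ 5)) / D)
      = 30 * b * s ^ 4 / ((P ^ 6 + K) * D) * slope s"
  proof -
    have "x / A - y / D = 30 * b * s ^ 4 / (A * D) * (P ^ 5 * D - s * A)"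
      if "0 < A" "x = 30 * b * s ^ 4 * P ^ 5" "y = 30 * b * s ^ 5" for A x y
      using that D by (simp add: field_simps eval_nat_numeral)
    from this[OF P, of "6 * P ^ 5 * (b * (5 * s ^ 4))" "30 * b * s ^ 5"]
    show ?thesis unfolding \<open>P ^ 5 * D - s * (P ^ 6 + K) = slope s\<close> by simp
  qed
  moreover have "0 \<le> 30 * b * s ^ 4 / ((P ^ 6 + K) * D)" using P D pos by simp
  ultimately show ?thesis using that[of "30 * b * s ^ 4 / ((P ^ 6 + K) * D)"] by simp
qed

lemma profile_mono:
  assumes "0 \<le> s" "s \<le> t" "\<And>x. s \<le> x \<Longrightarrow> x \<le> t \<Longrightarrow> 0 \<le> slope x"
  shows "profile s \<le> profile t"
proof (rule DERIV_nonneg_imp_nondecreasing[OF assms(2)])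
  fix x assume x: "s \<le> x" "x \<le> t"
  with assms(1) have x0: "0 \<le> x" by simp
  obtain w where "0 \<le> w" "(profile has_real_derivative w * slope x) (at x)"
    using deriv_profile[OF x0] .
  with assms(3)[OF x] show "\<exists>y. (profile has_real_derivative y) (at x) \<and> 0 \<le> y"
    by (blast intro: mult_nonneg_nonneg)
qed

lemma profile_antimono:
  assumes "0 \<le> s" "s \<le> t" "\<And>x. s \<le> x \<Longrightarrow> x \<le> t \<Longrightarrow> slope x \<le> 0"
  shows "profile t \<le> profile s"
proof (rule DERIV_nonpos_imp_nonincreasing[OF assms(2)])
  fix x assume x: "s \<le> x" "x \<le> t"
  with assms(1) have x0: "0 \<le> x" by simp
  obtain w where "0 \<le> w" "(profile has_real_derivative w * slope x) (at x)"
    using deriv_profile[OF x0] .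
  with assms(3)[OF x] show "\<exists>y. (profile has_real_derivative y) (at x) \<and> y \<le> 0"
    by (blast intro: mult_nonneg_nonpos)
qed

lemma slope_iff:
  assumes "0 < s" "k * s < m"
  shows "0 \<le> slope s \<longleftrightarrow> ln K \<le> log_slope s" and "slope s \<le> 0 \<longleftrightarrow> log_slope s \<le> ln K"
proof -
  define P where "P = k + b * s ^ 5"
  have P: "0 < P" using P_pos assms by (simp add: P_def)
  have l: "log_slope s + ln s = ln (P ^ 5 * (m - k * s))"
    using P assms by (simp add: log_slope_def P_def[symmetric] ln_mult ln_realpow)
  have r: "ln K + ln s = ln (K * s)" using pos assms by (simp add: ln_mult)
  have "0 < P ^ 5 * (m - k * s)" "0 < K * s" using P pos assms by auto
  then have "K * s \<le> P ^ 5 * (m - k * s) \<longleftrightarrow> ln K + ln s \<le> log_slope s + ln s"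
    "P ^ 5 * (m - k * s) \<le> K * s \<longleftrightarrow> log_slope s + ln s \<le> ln K + ln s"
    unfolding l r by simp_all
  then show "0 \<le> slope s \<longleftrightarrow> ln K \<le> log_slope s" "slope s \<le> 0 \<longleftrightarrow> log_slope s \<le> ln K"
    by (simp_all add: slope_def P_def[symmetric])
qed

lemma slope_neg: "0 \<le> s \<Longrightarrow> m \<le> k * s \<Longrightarrow> slope s \<le> 0"
  using P_pos[of s] pos by (simp add: slope_def mult_nonneg_nonpos order_trans[of _ 0])

lemma deriv_log_slope:
  assumes "0 < s" "k * s < m"
  obtains w where "0 \<le> w" "(log_slope has_real_derivative w * turn s) (at s)"
proof -
  define P where "P = k + b * s ^ 5"
  have P: "0 < P" using P_pos assms by (simp add: P_def)
  define R where "R = m - k * s"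
  have R: "0 < R" using assms by (simp add: R_def)
  have "(log_slope has_real_derivative
      5 * ((b * (5 * s ^ 4)) / P) + (- k) / R - 1 / s) (at s)"
    unfolding log_slope_def[abs_def]
    using P R assms by (auto intro!: derivative_eq_intros simp: P_def R_def)
  moreover have "turn s = 25 * b * s ^ 5 * R - k * s * P - P * R"
    by (simp add: turn_def R_def P_def eval_nat_numeral algebra_simps)
  then have "5 * ((b * (5 * s ^ 4)) / P) + (- k) / R - 1 / s = 1 / (P * (s * R)) * turn s"
    using P R assms(1) by (simp add: field_simps eval_nat_numeral)
  moreover have "0 \<le> 1 / (P * (s * R))" using P R assms(1) by simp
  ultimately show ?thesis using that[of "1 / (P * (s * R))"] by simp
qed

lemma log_slope_mono:
  assumes "0 < s" "s \<le> t" "k * t < m" "\<And>x. s \<le> x \<Longrightarrow> x \<le> t \<Longrightarrow> 0 \<le> turn x"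
  shows "log_slope s \<le> log_slope t"
proof (rule DERIV_nonneg_imp_nondecreasing[OF assms(2)])
  fix x assume x: "s \<le> x" "x \<le> t"
  then have "k * x \<le> k * t" using pos by simp
  with x assms have x0: "0 < x" "k * x < m" by linarith+
  obtain w where "0 \<le> w" "(log_slope has_real_derivative w * turn x) (at x)"
    using deriv_log_slope[OF x0] .
  with assms(4)[OF x] show "\<exists>y. (log_slope has_real_derivative y) (at x) \<and> 0 \<le> y"
    by (blast intro: mult_nonneg_nonneg)
qed

lemma log_slope_antimono:
  assumes "0 < s" "s \<le> t" "k * t < m" "\<And>x. s \<le> x \<Longrightarrow> x \<le> t \<Longrightarrow> turn x \<le> 0"
  shows "log_slope t \<le> log_slope s"
proof (rule DERIV_nonpos_imp_nonincreasing[OF assms(2)])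
  fix x assume x: "s \<le> x" "x \<le> t"
  then have "k * x \<le> k * t" using pos by simp
  with x assms have x0: "0 < x" "k * x < m" by linarith+
  obtain w where "0 \<le> w" "(log_slope has_real_derivative w * turn x) (at x)"
    using deriv_log_slope[OF x0] .
  with assms(4)[OF x] show "\<exists>y. (log_slope has_real_derivative y) (at x) \<and> y \<le> 0"
    by (blast intro: mult_nonneg_nonpos)
qed

text \<open>While \<open>turn\<close> is nonpositive, \<open>log_slope\<close> decreases, so
  \<open>slope\<close> is nonnegative before the critical point and nonpositive after it. The
  logarithms break down at 0 and from \<open>m <= k * x\<close> on; there the sign of
  \<open>slope\<close> is evident.\<close>

lemma profile_le_critical:
  assumes t: "0 < t" "slope t = 0" and s: "0 \<le> s"
    and turn: "\<And>x. 0 < x \<Longrightarrow> min s t \<le> x \<Longrightarrow> x \<le> max s t \<Longrightarrow> turn x \<le> 0"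
  shows "profile s \<le> profile t"
proof -
  have kt: "k * t < m"
    using slope_def[of t] t P_pos[of t] pos by (smt (verit) mult_nonneg_nonpos mult_pos_pos zero_less_power)
  have lt: "log_slope t = ln K"
    using slope_iff[OF t(1) kt] t(2) by linarith
  show ?thesis
  proof (cases "s \<le> t")
    case True
    have "0 \<le> slope x" if x: "s \<le> x" "x \<le> t" for x
    proof (cases "x = 0")
      case True
      with pos show ?thesis by (simp add: slope_def)
    next
      case False
      with s x have x0: "0 < x" by simp
      have "k * x \<le> k * t" using pos x by simp
      with kt have kx: "k * x < m" by simp
      have "log_slope t \<le> log_slope x"
        using x x0 True by (intro log_slope_antimono[OF _ x(2) kt] turn) auto
      with lt slope_iff(1)[OF x0 kx] show ?thesis by simp
    qed
    with True s show ?thesis by (intro profile_mono)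
  next
    case False
    have "slope x \<le> 0" if x: "t \<le> x" "x \<le> s" for x
    proof (cases "k * x < m")
      case True
      have "log_slope x \<le> log_slope t"
        using x t False by (intro log_slope_antimono[OF t(1) x(1) True] turn) auto
      with lt slope_iff(2)[OF _ True] x t show ?thesis by simp
    next
      case False
      with x t show ?thesis by (intro slope_neg) auto
    qed
    with False t show ?thesis by (intro profile_antimono) auto
  qed
qed

text \<open>Between two critical points of equal height the sign pattern \<open>-, +, -\<close> of \<open>turn\<close> leaves
  room for a single further critical point, a minimum.\<close>

lemma profile_le_between:
  assumes l: "0 < l" "slope l = 0" and r: "slope r = 0" "k * r < m"
    and eq: "profile l = profile r"
    and order: "l \<le> y\<^sub>1" "y\<^sub>1 \<le> y\<^sub>2" "y\<^sub>2 \<le> r"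
    and turn: "\<And>x. l \<le> x \<Longrightarrow> x \<le> y\<^sub>1 \<Longrightarrow> turn x \<le> 0" "\<And>x. y\<^sub>1 \<le> x \<Longrightarrow> x \<le> y\<^sub>2 \<Longrightarrow> 0 \<le> turn x"
      "\<And>x. y\<^sub>2 \<le> x \<Longrightarrow> x \<le> r \<Longrightarrow> turn x \<le> 0"
    and s: "l \<le> s" "s \<le> r"
  shows "profile s \<le> profile r"
proof -
  have km: "k * x < m" if "x \<le> r" for x
  proof -
    have "k * x \<le> k * r" using pos that by simp
    with r(2) show ?thesis by simp
  qed
  have pl: "log_slope l = ln K"
    using slope_iff[OF l(1) km] l(2) order by (intro order.antisym) simp_all
  have "0 < r" using l order by linarith
  then have pr: "log_slope r = ln K"
    using slope_iff[OF _ r(2)] r(1) by (intro order.antisym) simp_all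
  have low: "slope x \<le> 0" if "l \<le> x" "x \<le> y\<^sub>1" for x
  proof -
    have "log_slope x \<le> log_slope l"
      using that l order by (intro log_slope_antimono km turn) auto
    with pl that l order show ?thesis by (subst slope_iff) (auto intro: km)
  qed
  have high: "0 \<le> slope x" if "y\<^sub>2 \<le> x" "x \<le> r" for x
  proof -
    have "log_slope r \<le> log_slope x"
      using that l order r by (intro log_slope_antimono turn) auto
    with pr that l order show ?thesis by (subst slope_iff) (auto intro: km)
  qed
  have mid: "log_slope x \<le> log_slope y" if "y\<^sub>1 \<le> x" "x \<le> y" "y \<le> y\<^sub>2" for x y
    using that l order by (intro log_slope_mono km turn) auto
  have down: "profile s \<le> profile l" if "\<And>x. l \<le> x \<Longrightarrow> x \<le> s \<Longrightarrow> slope x \<le> 0"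
    using that s l by (intro profile_antimono) auto
  have up: "profile s \<le> profile r" if "\<And>x. s \<le> x \<Longrightarrow> x \<le> r \<Longrightarrow> 0 \<le> slope x"
    using that s l by (intro profile_mono) auto
  \<comment> \<open>On the rising stretch of \<open>log_slope\<close>, the sign of
    \<open>log_slope s - ln K\<close> decides which peak to use: \<open>slope\<close> is then
    nonpositive all the way from \<open>l\<close> or nonnegative all the way to
    \<open>r\<close>.\<close>
  consider "s \<le> y\<^sub>1" | "y\<^sub>2 \<le> s" | "y\<^sub>1 \<le> s" "s \<le> y\<^sub>2" "log_slope s \<le> ln K"
    | "y\<^sub>1 \<le> s" "s \<le> y\<^sub>2" "ln K \<le> log_slope s" by linarith
  then show ?thesis
  proof cases
    case 1
    then show ?thesis using down low eq by auto
  next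
    case 2
    then show ?thesis using up high by auto
  next
    case 3
    have "slope x \<le> 0" if "l \<le> x" "x \<le> s" for x
    proof (cases "x \<le> y\<^sub>1")
      case False
      with that 3 mid[of x s] have "log_slope x \<le> ln K" by auto
      with that 3 l order show ?thesis by (subst slope_iff) (auto intro: km)
    qed (use that low in auto)
    then show ?thesis using down eq by auto
  next
    case 4
    have "0 \<le> slope x" if "s \<le> x" "x \<le> r" for x
    proof (cases "y\<^sub>2 \<le> x")
      case False
      with that 4 mid[of s x] have "ln K \<le> log_slope x" by auto
      with that 4 l order show ?thesis by (subst slope_iff) (auto intro: km)
    qed (use that high in auto)
    then show ?thesis using up by auto
  qed
qed

end

section \<open>The contraction at the extremal phases\<close>

interpretation unit_profile: edge_profile 1 1 1 1
  by unfold_locales simp_all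

text \<open>\<open>turn\<close> increases up to 4/5, where it is positive, and decreases afterwards.
  It is negative at 5/8 and 9/10, values chosen to lie between its two zeros and the peaks
  \<open>s_low\<close> and \<open>s_high\<close>.\<close>

lemma unit_turn_sign_pattern:
  defines "T \<equiv> unit_profile.turn"
  obtains y\<^sub>1 y\<^sub>2 where "5/8 \<le> y\<^sub>1" "y\<^sub>1 \<le> y\<^sub>2" "y\<^sub>2 \<le> 9/10"
    "\<forall>x. 0 \<le> x \<longrightarrow> x \<le> y\<^sub>1 \<longrightarrow> T x \<le> 0" "\<forall>x. y\<^sub>1 \<le> x \<longrightarrow> x \<le> y\<^sub>2 \<longrightarrow> 0 \<le> T x"
    "\<forall>x. y\<^sub>2 \<le> x \<longrightarrow> T x \<le> 0"
proof -
  have T: "T x = x ^ 5 * (24 - 25 * x) - 1" for x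
    by (simp add: T_def unit_profile.turn_def)
  have d: "(T has_real_derivative 30 * x ^ 4 * (4 - 5 * x)) (at x)" for x
    unfolding T[abs_def] by (auto intro!: derivative_eq_intros simp: algebra_simps eval_nat_numeral)
  have inc: "T x \<le> T y" if "x \<le> y" "y \<le> 4/5" for x y
    using that d by (intro DERIV_nonneg_imp_nondecreasing[of x y T]) (auto intro!: exI mult_nonneg_nonneg)
  have dec: "T y \<le> T x" if "x \<le> y" "4/5 \<le> x" for x y
    using that d by (intro DERIV_nonpos_imp_nonincreasing[of x y T]) (auto intro!: exI mult_nonneg_nonpos)
  have c: "isCont T x" for x using d by (rule DERIV_isCont)
  have v: "T (5/8) \<le> 0" "0 \<le> T (4/5)" "T (9/10) \<le> 0"
    by (simp_all add: T eval_nat_numeral)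
  obtain y\<^sub>1 where y1: "5/8 \<le> y\<^sub>1" "y\<^sub>1 \<le> 4/5" "T y\<^sub>1 = 0"
    using IVT[of T "5/8" 0 "4/5"] v c by auto
  obtain y\<^sub>2 where y2: "4/5 \<le> y\<^sub>2" "y\<^sub>2 \<le> 9/10" "T y\<^sub>2 = 0"
    using IVT2[of T "9/10" 0 "4/5"] v c by auto
  show thesis
  proof (rule that[of y\<^sub>1 y\<^sub>2]; (intro allI impI)?)
    show "0 \<le> T x" if x: "y\<^sub>1 \<le> x" "x \<le> y\<^sub>2" for x
    proof (cases "x \<le> 4/5")
      case True then show ?thesis using inc[OF x(1)] y1 by simp
    next
      case False then show ?thesis using dec[OF x(2)] y2 by simp
    qed
  qed (use y1 y2 inc[of _ y\<^sub>1] dec[of y\<^sub>2] in auto)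
qed

text \<open>\<open>x\<close> and \<open>y\<close> are the effective activities of the two ends of an
  edge, each absorbing its five other branches; the equations are the tree recursion at fugacity 1.
  The bounds exclude the symmetric solution \<open>x = y\<close>.\<close>

locale two_phase =
  fixes x y :: real
  assumes x: "0 < x" "x \<le> 1/12" and y: "2/3 \<le> y" "y \<le> 1"
    and xy: "x * (1 + y) ^ 5 = 1" and yx: "y * (1 + x) ^ 5 = 1"
begin

definition Z where "Z = 1 + x + y"

definition "p_low = x / Z"
definition "p_high = y / Z"

lemma Z_pos: "0 < Z" using x y by (simp add: Z_def)

lemma densities: "0 < p_low" "0 < p_high" "p_low + p_high < 1"
  using x y Z_pos by (auto simp: p_low_def p_high_def divide_less_eq add_divide_distrib[symmetric]) (simp add: Z_def)

lemma complements:
  "1 - p_low = (1 + y) / Z" "1 - p_high = (1 + x) / Z" "1 - p_low - p_high = 1 / Z"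
proof -
  have "1 - p_low = (Z - x) / Z" "1 - p_high = (Z - y) / Z" "1 - p_low - p_high = (Z - x - y) / Z"
    using Z_pos by (simp_all add: p_low_def p_high_def diff_divide_distrib)
  then show "1 - p_low = (1 + y) / Z" "1 - p_high = (1 + x) / Z" "1 - p_low - p_high = 1 / Z"
    by (simp_all add: Z_def)
qed

text \<open>The fifth roots of \<open>y\<close> and \<open>x\<close>, in closed form thanks to the
  recursion. Reweighting the second side from activity \<open>y\<close> to \<open>x\<close>
  exchanges the phases.\<close>

definition "s_high = 1 / (1 + x)"
definition "s_low = 1 / (1 + y)"

lemma s_powers: "s_high ^ 5 = y" "s_low ^ 5 = x"
  using x y xy yx by (auto simp: s_high_def s_low_def power_one_over field_simps)

lemma s_pos: "0 < s_high" "0 < s_low" "s_high < 1"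
  using x y by (auto simp: s_high_def s_low_def)

lemma s_bounds: "9/10 \<le> s_high" "s_low \<le> 5/8"
  using x y by (auto simp: s_high_def s_low_def field_simps)

lemma slopes: "unit_profile.slope s_high = 0" "unit_profile.slope s_low = 0"
proof -
  have "(1 + y) ^ 5 * (1 - s_high) = (1 + y) ^ 5 * x * s_high"
    using x by (simp add: s_high_def field_simps)
  then show "unit_profile.slope s_high = 0"
    using xy by (simp add: unit_profile.slope_def s_powers mult.commute)
  have "(1 + x) ^ 5 * (1 - s_low) = (1 + x) ^ 5 * y * s_low"
    using y by (simp add: s_low_def field_simps)
  then show "unit_profile.slope s_low = 0"
    using yx by (simp add: unit_profile.slope_def s_powers mult.commute)
qed

lemma peak_values:
  "(1 + s_high ^ 5) ^ 6 + 1 = (1 + y) ^ 5 * Z" "1 + s_high ^ 6 = Z / (1 + x)"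
  "(1 + s_low ^ 5) ^ 6 + 1 = (1 + x) ^ 5 * Z" "1 + s_low ^ 6 = Z / (1 + y)"
proof -
  have e: "t ^ 6 = t ^ 5 * t" for t :: real by (simp add: eval_nat_numeral)
  show "(1 + s_high ^ 5) ^ 6 + 1 = (1 + y) ^ 5 * Z"
    unfolding s_powers unfolding e Z_def using xy by (simp add: algebra_simps)
  show "(1 + s_low ^ 5) ^ 6 + 1 = (1 + x) ^ 5 * Z"
    unfolding s_powers unfolding e Z_def using yx by (simp add: algebra_simps)
  show "1 + s_high ^ 6 = Z / (1 + x)" "1 + s_low ^ 6 = Z / (1 + y)"
    unfolding e s_powers using x y by (simp_all add: s_high_def s_low_def Z_def field_simps)
qed

definition "peak = 5 * ln (1 + x) + 5 * ln (1 + y) - 4 * ln Z"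

text \<open>The recursion reduces both values to one expression symmetric in \<open>x\<close> and
  \<open>y\<close>; this is the equality of heights.\<close>

lemma profile_peaks:
  "unit_profile.profile s_high = peak" "unit_profile.profile s_low = peak"
  unfolding unit_profile.profile_def
  using x y Z_pos by (simp_all add: peak_values peak_def ln_mult ln_div ln_realpow)

lemma profile_le_peak:
  assumes "0 \<le> s"
  shows "unit_profile.profile s \<le> peak"
proof -
  obtain y\<^sub>1 y\<^sub>2 where sh: "5/8 \<le> y\<^sub>1" "y\<^sub>1 \<le> y\<^sub>2" "y\<^sub>2 \<le> 9/10"
    "\<forall>x. 0 \<le> x \<longrightarrow> x \<le> y\<^sub>1 \<longrightarrow> unit_profile.turn x \<le> 0"
    "\<forall>x. y\<^sub>1 \<le> x \<longrightarrow> x \<le> y\<^sub>2 \<longrightarrow> 0 \<le> unit_profile.turn x"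
    "\<forall>x. y\<^sub>2 \<le> x \<longrightarrow> unit_profile.turn x \<le> 0"
    by (rule unit_turn_sign_pattern)
  note b = s_bounds s_pos
  consider "s \<le> s_low" | "s_low \<le> s" "s \<le> s_high" | "s_high \<le> s" by linarith
  then show ?thesis
  proof cases
    case 1
    have "unit_profile.profile s \<le> unit_profile.profile s_low"
      using 1 b sh(1) assms
      by (intro unit_profile.profile_le_critical slopes sh(4)[rule_format]) auto
    then show ?thesis by (simp add: profile_peaks)
  next
    case 2
    have "unit_profile.profile s \<le> unit_profile.profile s_high"
      using b sh(1-3) 2
      by (intro unit_profile.profile_le_between[of s_low s_high y\<^sub>1 y\<^sub>2] slopes sh(4-6)[rule_format])
        (auto simp: profile_peaks)
    then show ?thesis by (simp add: profile_peaks)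
  next
    case 3
    have "unit_profile.profile s \<le> unit_profile.profile s_high"
      using 3 b sh(3) assms
      by (intro unit_profile.profile_le_critical slopes sh(6)[rule_format]) auto
    then show ?thesis by (simp add: profile_peaks)
  qed
qed

lemma profile_bound:
  assumes "0 \<le> s"
  shows "((1 + s ^ 5) ^ 6 + 1) * Z ^ 4 \<le> ((1 + x) * (1 + y) * (1 + s ^ 6)) ^ 5"
proof -
  have p: "0 < 1 + s ^ 5" "0 < 1 + s ^ 6" using assms by (auto intro!: add_pos_nonneg)
  then have p': "0 < (1 + s ^ 5) ^ 6 + 1" by (intro add_pos_pos) auto
  have "ln (((1 + s ^ 5) ^ 6 + 1) * Z ^ 4) \<le> ln (((1 + x) * (1 + y) * (1 + s ^ 6)) ^ 5)"
    using profile_le_peak[OF assms] p p' Z_pos x y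
    by (simp add: unit_profile.profile_def peak_def ln_mult ln_realpow)
  then show ?thesis
    using p p' Z_pos x y by (subst (asm) ln_le_cancel_iff) auto
qed

text \<open>By homogeneity only \<open>c\<^sub>1 / c\<^sub>0\<close> matters. The factor
  \<open>s_high\<close> absorbs \<open>y\<close>, and \<open>x * (1 + y) ^ 5 = 1\<close> makes the
  additive constant 1, which leaves \<open>profile_bound\<close>. The case
  \<open>c\<^sub>0 = 0\<close>, where s would be infinite, is estimated directly.\<close>

lemma contracts_densities:
  assumes "0 \<le> c\<^sub>0" "0 \<le> c\<^sub>1"
  shows "contracts p_low p_high c\<^sub>0 c\<^sub>1"
proof (cases "c\<^sub>0 = 0")
  case True
  have "p_high ^ 6 * Z ^ 5 = p_high ^ 5 * (y * Z ^ 4)"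
    using Z_pos by (simp add: p_high_def eval_nat_numeral)
  also have "\<dots> \<le> p_high ^ 5 * (1 + y) ^ 5"
  proof (rule mult_left_mono)
    have "y * Z ^ 4 \<le> 1 * (1 + x + y) ^ 4"
      unfolding Z_def using y x by (intro mult_right_mono) auto
    \<comment> \<open>Crude bounds suffice: \<open>x <= 1/12 <= (1 + y) / 10\<close> and
      \<open>(11/10) ^ 4 < 3/2 < 1 + y\<close>.\<close>
    also have "(1 + x + y) ^ 4 \<le> (11/10 * (1 + y)) ^ 4"
      using x y by (intro power_mono) auto
    also have "\<dots> \<le> (1 + y) * (1 + y) ^ 4"
      using y by (simp only: power_mult_distrib, intro mult_right_mono) (auto simp: eval_nat_numeral)
    finally show "y * Z ^ 4 \<le> (1 + y) ^ 5" by (simp add: eval_nat_numeral)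
  qed (use densities in simp)
  finally have key: "p_high ^ 6 * Z ^ 5 \<le> p_high ^ 5 * (1 + y) ^ 5" .
  have "(1 - p_low) * (p_high * c\<^sub>1 ^ 5 / (1 - p_low)) ^ 6 = p_high ^ 6 * Z ^ 5 / (1 + y) ^ 5 * c\<^sub>1 ^ 30"
  proof -
    have "A / Z * (w / (A / Z)) ^ 6 = w ^ 6 * Z ^ 5 / A ^ 5" if "0 < A" for A w
      using that Z_pos by (simp add: power_divide power_mult_distrib eval_nat_numeral)
    from this[of "1 + y" "p_high * c\<^sub>1 ^ 5"] show ?thesis
      unfolding complements using y by (simp add: power_mult_distrib power_mult[symmetric])
  qed
  also have "\<dots> \<le> p_high ^ 5 * c\<^sub>1 ^ 30"
    using key y by (intro mult_right_mono) (auto simp: divide_le_eq)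
  finally show ?thesis
    using True by (simp add: contracts_def power_mult_distrib power_mult[symmetric])
next
  case False
  with assms have c0: "0 < c\<^sub>0" by simp
  define s where "s = c\<^sub>1 / c\<^sub>0 * s_high"
  have s: "0 \<le> s" using assms s_pos by (simp add: s_def)
  have c1: "c\<^sub>1 ^ 5 * y = s ^ 5 * c\<^sub>0 ^ 5"
    using c0 by (simp add: s_def power_mult_distrib power_divide s_powers)
  have c1': "c\<^sub>1 ^ 6 * y = s ^ 6 * c\<^sub>0 ^ 6 * (1 + x)"
  proof -
    have "s_high ^ 6 = y / (1 + x)"
      using s_powers(1) by (simp add: s_high_def eval_nat_numeral)
    then show ?thesis
      using c0 x by (simp add: s_def power_mult_distrib power_divide)
  qed
  have W: "((1 - p_low - p_high) * c\<^sub>0 ^ 5 + p_high * c\<^sub>1 ^ 5) / (1 - p_low) = (1 + s ^ 5) * c\<^sub>0 ^ 5 / (1 + y)"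
  proof -
    have n: "(1 - p_low - p_high) * c\<^sub>0 ^ 5 + p_high * c\<^sub>1 ^ 5 = (c\<^sub>0 ^ 5 + c\<^sub>1 ^ 5 * y) / Z"
      by (simp add: complements p_high_def add_divide_distrib mult.commute)
    have c: "w / Z / ((1 + y) / Z) = w / (1 + y)" for w using Z_pos by simp
    show ?thesis unfolding n c1 unfolding complements(1) c by (simp add: distrib_right)
  qed
  have "(1 - p_low) * ((1 + s ^ 5) * c\<^sub>0 ^ 5 / (1 + y)) ^ 6 + p_low * (c\<^sub>0 ^ 5) ^ 6
      = ((1 + s ^ 5) ^ 6 + x * (1 + y) ^ 5) / ((1 + y) ^ 5 * Z) * c\<^sub>0 ^ 30"
  proof -
    have "A / Z * (w * c / A) ^ 6 = w ^ 6 / (A ^ 5 * Z) * c ^ 6" if "0 < A" for A w c :: real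
      using that Z_pos by (simp add: eval_nat_numeral mult.commute mult.left_commute)
    from this[of "1 + y" "1 + s ^ 5" "c\<^sub>0 ^ 5"]
    have "(1 - p_low) * ((1 + s ^ 5) * c\<^sub>0 ^ 5 / (1 + y)) ^ 6
        = (1 + s ^ 5) ^ 6 / ((1 + y) ^ 5 * Z) * c\<^sub>0 ^ 30"
      unfolding complements(1) using y by (simp add: power_mult[symmetric])
    moreover have "p_low = x * (1 + y) ^ 5 / ((1 + y) ^ 5 * Z)"
      using y by (simp add: p_low_def)
    ultimately show ?thesis
      by (simp add: add_divide_distrib distrib_right power_mult[symmetric])
  qed
  also have "\<dots> = ((1 + s ^ 5) ^ 6 + 1) * Z ^ 4 / ((1 + y) * Z) ^ 5 * c\<^sub>0 ^ 30"
  proof -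
    have "A / (B * Z) = A * Z ^ 4 / (B * Z ^ 5)" for A B
      using Z_pos by (simp add: eval_nat_numeral)
    then show ?thesis unfolding xy power_mult_distrib by simp
  qed
  also have "\<dots> \<le> ((1 + x) * (1 + y) * (1 + s ^ 6)) ^ 5 / ((1 + y) * Z) ^ 5 * c\<^sub>0 ^ 30"
    using Z_pos y by (intro mult_right_mono divide_right_mono profile_bound s) auto
  also have "\<dots> = ((1 + x) * (1 + s ^ 6) / Z * c\<^sub>0 ^ 6) ^ 5"
    using Z_pos y by (simp add: power_mult_distrib power_divide power_mult[symmetric])
  also have "(1 + x) * (1 + s ^ 6) / Z * c\<^sub>0 ^ 6 = (1 - p_high) * c\<^sub>0 ^ 6 + p_high * c\<^sub>1 ^ 6"
  proof -
    have "(1 - p_high) * c\<^sub>0 ^ 6 + p_high * c\<^sub>1 ^ 6 = ((1 + x) * c\<^sub>0 ^ 6 + c\<^sub>1 ^ 6 * y) / Z"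
      unfolding complements(2) unfolding p_high_def using Z_pos by (simp add: field_simps)
    then show ?thesis unfolding c1' by (simp add: algebra_simps)
  qed
  finally show ?thesis unfolding contracts_def W .
qed

text \<open>Equivalent to \<open>25 * p_low * p_high < (1 - p_low) * (1 - p_high)\<close>: it makes \<open>turn\<close> negative at \<open>1\<close>.\<close>

lemma densities_stable:
  "p_high * (24 * (1 - p_high) - 25 * (1 - p_low - p_high)) - (1 - p_low - p_high) * (1 - p_high) < 0"
proof -
  have "y * (24 * (1 + x) - 25) - (1 + x) < 0"
  proof -
    have "y * (24 * (1 + x) - 25) \<le> y * 1"
      using x y by (intro mult_left_mono) auto
    then show ?thesis using x y by linarith
  qed
  moreover have "p_high * (24 * (1 - p_high) - 25 * (1 - p_low - p_high)) - (1 - p_low - p_high) * (1 - p_high)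
    = (y * (24 * (1 + x) - 25) - (1 + x)) / Z ^ 2"
    unfolding complements(3) unfolding complements(2) unfolding p_high_def using Z_pos by (simp add: field_simps power2_eq_square)
  ultimately show ?thesis using Z_pos by (simp add: divide_neg_pos)
qed

end

section \<open>Independent sets of the tree\<close>

text \<open>Two branching numbers, as the root is exceptional: \<open>b = 5\<close>,
  \<open>r = 6\<close> gives balls of the 6-regular tree, and \<open>r = b\<close> the branches
  below a child, on which the recursion runs.\<close>

definition verts :: "nat \<Rightarrow> nat \<Rightarrow> nat \<Rightarrow> nat list set" where
  "verts b r n = {v. length v \<le> n \<and> (\<forall>i<length v. v ! i < (if i = 0 then r else b))}"

definition full_sets :: "nat \<Rightarrow> nat \<Rightarrow> nat \<Rightarrow> nat list set set" where
  "full_sets b r n = {I \<in> independent_sets (verts b r n) tree_adj. \<forall>v\<in>verts b r n. length v = n \<longrightarrow> v \<in> I}"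

definition branch :: "nat \<Rightarrow> nat list set \<Rightarrow> nat list set" where
  "branch i I = {w. i # w \<in> I}"

lemma verts_Cons: "i # w \<in> verts b r (Suc n) \<longleftrightarrow> i < r \<and> w \<in> verts b b n"
  by (simp add: verts_def All_less_Suc2 conj_left_commute)

lemma verts_Nil [simp]: "[] \<in> verts b r n"
  by (simp add: verts_def)

lemma tree_adj_simps [simp]:
  "tree_adj (i # v) (j # w) \<longleftrightarrow> i = j \<and> tree_adj v w"
  "tree_adj [] (j # w) \<longleftrightarrow> w = []" "tree_adj (i # v) [] \<longleftrightarrow> v = []" "\<not> tree_adj [] []"
  by (auto simp: tree_adj_def)

lemma finite_verts: "finite (verts b r n)"
proof (rule finite_subset)
  show "verts b r n \<subseteq> {v. set v \<subseteq> {..<b + r} \<and> length v \<le> n}"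
  proof
    fix v assume v: "v \<in> verts b r n"
    have "x < b + r" if "x \<in> set v" for x
    proof -
      obtain i where "i < length v" "x = v ! i" using \<open>x \<in> set v\<close> by (metis in_set_conv_nth)
      with v have "x < (if i = 0 then r else b)" by (simp add: verts_def)
      then show ?thesis by (simp split: if_splits)
    qed
    with v show "v \<in> {v. set v \<subseteq> {..<b + r} \<and> length v \<le> n}" by (auto simp: verts_def)
  qed
qed (simp add: finite_lists_length_le)

lemma finite_full_sets: "finite (full_sets b r n)"
proof (rule finite_subset)
  show "full_sets b r n \<subseteq> Pow (verts b r n)"
    unfolding full_sets_def independent_sets_def by blast
qed (simp add: finite_verts)

lemma full_sets_Suc:
  "I \<in> full_sets b r (Suc n) \<longleftrightarrow>
     (\<forall>v\<in>I. v = [] \<or> (\<exists>i<r. \<exists>w. v = i # w)) \<and> (\<forall>i<r. branch i I \<in> full_sets b b n)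
     \<and> ([] \<in> I \<longrightarrow> (\<forall>i<r. [] \<notin> branch i I))" (is "?L \<longleftrightarrow> ?R")
proof
  assume L: ?L
  then have sub: "I \<subseteq> verts b r (Suc n)" and ind: "\<And>u v. u \<in> I \<Longrightarrow> v \<in> I \<Longrightarrow> \<not> tree_adj u v"
    and lev: "\<And>v. v \<in> verts b r (Suc n) \<Longrightarrow> length v = Suc n \<Longrightarrow> v \<in> I"
    by (auto simp: full_sets_def independent_sets_def)
  have "v = [] \<or> (\<exists>i<r. \<exists>w. v = i # w)" if "v \<in> I" for v
    using sub that by (cases v) (auto simp: verts_Cons dest!: subsetD)
  moreover have "branch i I \<in> full_sets b b n" if "i < r" for i
    using sub ind[of "i # _" "i # _"] lev[of "i # _"] that
    by (auto simp: full_sets_def independent_sets_def branch_def verts_Cons dest!: subsetD)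
  moreover have "[] \<in> I \<longrightarrow> (\<forall>i<r. [] \<notin> branch i I)"
    using ind[of "[]" "[_]"] by (auto simp: branch_def)
  ultimately show ?R by blast
next
  assume R: ?R
  have br: "i < r \<and> w \<in> verts b b n" if "i # w \<in> I" for i w
    using R that by (auto simp: full_sets_def independent_sets_def branch_def)
  have "v \<in> verts b r (Suc n)" if "v \<in> I" for v
    using that br by (cases v) (auto simp: verts_Cons)
  moreover have "\<not> tree_adj u v" if "u \<in> I" "v \<in> I" for u v
  proof (cases u; cases v)
    fix i w j w' assume uv: "u = i # w" "v = j # w'"
    then show ?thesis
      using R that br[of i w] by (auto simp: full_sets_def independent_sets_def branch_def)
  qed (use R that br in \<open>auto simp: branch_def\<close>)
  moreover have "v \<in> I" if "v \<in> verts b r (Suc n)" "length v = Suc n" for v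
    using that R by (cases v) (auto simp: verts_Cons full_sets_def branch_def)
  ultimately show ?L
    by (auto simp: full_sets_def independent_sets_def)
qed

definition graft :: "nat \<Rightarrow> bool \<Rightarrow> (nat \<Rightarrow> nat list set) \<Rightarrow> nat list set" where
  "graft r c J = {v. case v of [] \<Rightarrow> c | i # w \<Rightarrow> i < r \<and> w \<in> J i}"

lemma graft_simps [simp]: "[] \<in> graft r c J \<longleftrightarrow> c" "i # w \<in> graft r c J \<longleftrightarrow> i < r \<and> w \<in> J i"
  by (auto simp: graft_def)

lemma branch_graft: "branch i (graft r c J) = (if i < r then J i else {})"
  by (auto simp: branch_def)

text \<open>Given the root's spin the branches are independent: a vacant root leaves them free, an
  occupied one only forces their roots to be vacant. Hence an \<open>r\<close>-th power.\<close>

lemma card_full_sets_Suc: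
  "card {I \<in> full_sets b r (Suc n). ([] \<in> I) = c} = card {J \<in> full_sets b b n. c \<longrightarrow> [] \<notin> J} ^ r"
proof -
  let ?X = "{I \<in> full_sets b r (Suc n). ([] \<in> I) = c}"
  let ?Y = "{..<r} \<rightarrow>\<^sub>E {J \<in> full_sets b b n. c \<longrightarrow> [] \<notin> J}"
  have "bij_betw (\<lambda>I. \<lambda>i\<in>{..<r}. branch i I) ?X ?Y"
  proof (rule bij_betw_byWitness[where f' = "graft r c"])
    show "\<forall>I\<in>?X. graft r c (\<lambda>i\<in>{..<r}. branch i I) = I"
    proof
      fix I assume I: "I \<in> ?X"
      then have nil: "([] \<in> I) = c" and sub: "\<forall>v\<in>I. v = [] \<or> (\<exists>i<r. \<exists>w. v = i # w)"
        unfolding full_sets_Suc by auto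
      have "v \<in> graft r c (\<lambda>i\<in>{..<r}. branch i I) \<longleftrightarrow> v \<in> I" for v
        using sub nil by (cases v) (auto simp: branch_def)
      then show "graft r c (\<lambda>i\<in>{..<r}. branch i I) = I" by blast
    qed
    show "\<forall>J\<in>?Y. (\<lambda>i\<in>{..<r}. branch i (graft r c J)) = J"
      by (auto simp: branch_graft fun_eq_iff PiE_def extensional_def)
    show "(\<lambda>I. \<lambda>i\<in>{..<r}. branch i I) ` ?X \<subseteq> ?Y"
      by (auto simp: full_sets_Suc)
    show "graft r c ` ?Y \<subseteq> ?X"
    proof
      fix I assume "I \<in> graft r c ` ?Y"
      then obtain J where J: "J \<in> ?Y" and I: "I = graft r c J" by blast
      have "v = [] \<or> (\<exists>i<r. \<exists>w. v = i # w)" if "v \<in> I" for v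
        using that by (cases v) (auto simp: I)
      with J show "I \<in> ?X"
        by (auto simp: full_sets_Suc I branch_graft PiE_iff)
    qed
  qed
  then have "card ?X = card ?Y" by (rule bij_betw_same_card)
  then show ?thesis by (simp add: card_PiE)
qed

text \<open>At fugacity 1 probabilities are ratios of counts: this is the chance that the root of a
  \<open>b\<close>-ary tree is vacant given that level \<open>n\<close> is full. At
  \<open>n = 0\<close> the root is itself that level, so the recursion starts from 0.\<close>

definition vacancy :: "nat \<Rightarrow> nat \<Rightarrow> real" where
  "vacancy b n = card {I \<in> full_sets b b n. [] \<notin> I} / card (full_sets b b n)"

lemma card_full_sets_split:
  "card (full_sets b r n) = card {I \<in> full_sets b r n. [] \<notin> I} + card {I \<in> full_sets b r n. [] \<in> I}"
proof -
  have "full_sets b r n = {I \<in> full_sets b r n. [] \<notin> I} \<union> {I \<in> full_sets b r n. [] \<in> I}" by auto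
  then show ?thesis
    using card_Un_disjoint[of "{I \<in> full_sets b r n. [] \<notin> I}" "{I \<in> full_sets b r n. [] \<in> I}"]
      finite_full_sets[of b r n] by auto
qed

lemma full_sets_0: "full_sets b r 0 = {{[]}}"
proof -
  have "verts b r 0 = {[]}" by (auto simp: verts_def)
  then have "I \<in> full_sets b r 0 \<longleftrightarrow> I = {[]}" for I
    unfolding full_sets_def independent_sets_def by fastforce
  then show ?thesis by blast
qed

lemma card_full_sets_vacant:
  "card {I \<in> full_sets b r (Suc n). [] \<notin> I} = card (full_sets b b n) ^ r"
  using card_full_sets_Suc[of b r n False] by simp

lemma card_full_sets_occupied:
  "card {I \<in> full_sets b r (Suc n). [] \<in> I} = card {I \<in> full_sets b b n. [] \<notin> I} ^ r"
  using card_full_sets_Suc[of b r n True] by simp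

lemma card_full_sets_pos: "0 < card (full_sets b b n)"
proof (induction n)
  case 0
  then show ?case by (simp add: full_sets_0)
next
  case (Suc n)
  then show ?case
    by (subst card_full_sets_split) (simp add: card_full_sets_vacant)
qed

lemma vacancy_0: "vacancy b 0 = 0"
proof -
  have "{I \<in> full_sets b b 0. [] \<notin> I} = {}" by (auto simp: full_sets_0)
  then show ?thesis by (simp only: vacancy_def) simp
qed

lemma vacancy_Suc: "vacancy b (Suc n) = 1 / (1 + vacancy b n ^ b)"
proof -
  have p: "0 < real (card (full_sets b b n))" using card_full_sets_pos by simp
  show ?thesis
    unfolding vacancy_def card_full_sets_split[of b b "Suc n"] card_full_sets_vacant card_full_sets_occupied
    using p by (simp add: power_divide field_simps)
qed

section \<open>From counting to the root density of the Gibbs measures\<close>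

lemma hardcore_cond_prob_1:
  assumes "finite V"
  shows "hardcore_cond_prob V adj 1 S C =
    card (independent_sets V adj \<inter> (S \<inter> C)) / card (independent_sets V adj \<inter> C)"
proof -
  have "finite (independent_sets V adj)" "{} \<in> independent_sets V adj"
    using assms by (auto simp: independent_sets_def intro: finite_subset[of _ "Pow V"])
  then have "0 < card (independent_sets V adj)" by (auto simp: card_gt_0_iff)
  then show ?thesis by (simp add: hardcore_cond_prob_def hardcore_prob_def)
qed

text \<open>Level \<open>Suc n\<close> of the tree is level \<open>n\<close> of each branch, hence
  the shift of index. The root has \<open>Suc b\<close> branches, hence an exponent one larger than
  in the recursion for \<open>vacancy\<close>.\<close>

lemma full_level_prob_root:
  "full_level_prob (Suc b) 1 (Suc n) {I. I \<inter> {tree_root} = {tree_root}} =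
     vacancy b n ^ Suc b / (1 + vacancy b n ^ Suc b)"
proof -
  let ?r = "Suc b"
  have ball: "tree_ball ?r m = verts b ?r m" for m
    by (auto simp: tree_ball_def tree_vertices_def verts_def)
  have level: "tree_level ?r m = {v \<in> verts b ?r m. length v = m}" for m
    by (auto simp: tree_level_def tree_vertices_def verts_def)
  have C: "independent_sets (verts b ?r m) tree_adj \<inter> {I. tree_level ?r m \<subseteq> I} = full_sets b ?r m" for m
    by (auto simp: full_sets_def level)
  have S: "independent_sets (verts b ?r m) tree_adj
      \<inter> ({I. I \<inter> {tree_root} = {tree_root}} \<inter> {I. tree_level ?r m \<subseteq> I}) = {I \<in> full_sets b ?r m. [] \<in> I}" for m
    by (auto simp: full_sets_def level tree_root_def)
  have p: "0 < real (card (full_sets b b n))" using card_full_sets_pos by simp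
  have "full_level_prob ?r 1 (Suc n) {I. I \<inter> {tree_root} = {tree_root}} =
    real (card {I \<in> full_sets b ?r (Suc n). [] \<in> I}) / real (card (full_sets b ?r (Suc n)))"
    unfolding full_level_prob_def ball hardcore_cond_prob_1[OF finite_verts] S C ..
  also have "\<dots> = vacancy b n ^ ?r / (1 + vacancy b n ^ ?r)"
    unfolding vacancy_def card_full_sets_split[of b ?r "Suc n"] card_full_sets_vacant card_full_sets_occupied
    using p by (simp add: power_divide add_divide_distrib[symmetric] divide_simps)
  finally show ?thesis .
qed

lemma root_density_limit:
  assumes "full_level_limit d lam n M"
  shows "(\<lambda>l. full_level_prob d lam (n l) {I. I \<inter> {tree_root} = {tree_root}}) \<longlonglongrightarrow> root_density M"
proof -
  have "finite {tree_root} \<and> {tree_root} \<subseteq> tree_vertices d \<and> {tree_root} \<subseteq> {tree_root}"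
    by (simp add: tree_root_def tree_vertices_def)
  then have "(\<lambda>l. full_level_prob d lam (n l) {I. I \<inter> {tree_root} = {tree_root}})
      \<longlonglongrightarrow> measure M {\<sigma> \<in> space M. \<forall>v\<in>{tree_root}. \<sigma> v \<longleftrightarrow> v \<in> {tree_root}}"
    using assms[unfolded full_level_limit_def, THEN conjunct2, THEN conjunct2, rule_format] by blast
  then show ?thesis by (simp add: root_density_def)
qed

section \<open>Densities of the phases and nearby parameters\<close>

text \<open>Convergence comes from the hypotheses: inverting the map from vacancies to root
  densities carries it over to the odd terms, and the recursion to the even ones. The limits solve
  the two-step fixed-point equation, and invariant intervals keep them off the symmetric
  solution.\<close>

lemma two_phase_of_recursion:
  fixes t :: "nat \<Rightarrow> real"
  assumes t: "t 0 = 0" "\<And>n. t (Suc n) = 1 / (1 + t n ^ 5)"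
    and hi: "(\<lambda>l. t (2 * l + 1) ^ 6 / (1 + t (2 * l + 1) ^ 6)) \<longlonglongrightarrow> p"
    and lo: "(\<lambda>l. t (2 * l) ^ 6 / (1 + t (2 * l) ^ 6)) \<longlonglongrightarrow> p'"
  obtains x y where "two_phase x y" "p = two_phase.p_high x y" "p' = two_phase.p_low x y"
proof -
  define T :: "real \<Rightarrow> real" where "T u = 1 / (1 + u ^ 5)" for u
  define O' :: "real \<Rightarrow> real" where "O' u = u ^ 6 / (1 + u ^ 6)" for u
  have tS: "t (Suc n) = T (t n)" for n by (simp add: t T_def)
  \<comment> \<open>\<open>T\<close> exchanges [0, 3/5] and [12/13, 1]. The fifth powers of 3/5 and
    12/13 lie below 1/12 and above 2/3, which gives the bounds of \<open>two_phase\<close>.\<close>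
  have T1: "12/13 \<le> T u \<and> T u \<le> 1" if "0 \<le> u" "u \<le> 3/5" for u
  proof -
    have "u ^ 5 \<le> (3/5) ^ 5" using that by (intro power_mono) auto
    also have "(3/5 :: real) ^ 5 \<le> 1/12" by (simp add: power_divide)
    finally have "u ^ 5 \<le> 1/12" .
    then show ?thesis using that by (auto simp: T_def field_simps add_pos_nonneg)
  qed
  have T2: "0 \<le> T u \<and> T u \<le> 3/5" if "12/13 \<le> u" for u
  proof -
    have "(12/13) ^ 5 \<le> u ^ 5" using that by (intro power_mono) auto
    moreover have "2/3 \<le> (12/13 :: real) ^ 5" by (simp add: power_divide)
    ultimately have "2/3 \<le> u ^ 5" by linarith
    then show ?thesis by (auto simp: T_def field_simps add_pos_nonneg)
  qed
  have tlo: "0 \<le> t (2 * l) \<and> t (2 * l) \<le> 3/5" for l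
  proof (induction l)
    case (Suc l)
    then show ?case using T1 T2 by (simp add: tS)
  qed (simp add: t)
  have thi: "12/13 \<le> t (2 * l + 1) \<and> t (2 * l + 1) \<le> 1" for l
    using T1 tlo[of l] by (simp add: tS)
  have contT: "(\<lambda>l. T (f l)) \<longlonglongrightarrow> T u" if "f \<longlonglongrightarrow> u" "0 \<le> u" for f u
    unfolding T_def using that by (intro tendsto_intros) (auto simp: add_nonneg_eq_0_iff)
  have contO: "(\<lambda>l. O' (f l)) \<longlonglongrightarrow> O' u" if "f \<longlonglongrightarrow> u" for f u
  proof -
    have "1 + u ^ 6 \<noteq> 0" by (simp add: add_nonneg_eq_0_iff)
    then show ?thesis unfolding O'_def using that by (intro tendsto_intros)
  qed
  define h where "h = root 6 (p / (1 - p))"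
  \<comment> \<open>Keeps \<open>1 - p\<close> away from 0, so that the odds
    \<open>p / (1 - p)\<close> pass to the limit.\<close>
  have "O' (t (2 * l + 1)) \<le> 1/2" for l
  proof -
    have "t (2 * l + 1) ^ 6 \<le> 1" using thi[of l] by (intro power_le_one) auto
    then show ?thesis by (simp add: O'_def field_simps add_pos_nonneg)
  qed
  with hi have "p \<le> 1/2" by (intro LIMSEQ_le_const2[of _ p]) (auto simp: O'_def)
  then have "(\<lambda>l. root 6 (O' (t (2 * l + 1)) / (1 - O' (t (2 * l + 1))))) \<longlonglongrightarrow> h"
    unfolding h_def using hi by (intro tendsto_intros) (auto simp: O'_def)
  moreover have "root 6 (O' (t (2 * l + 1)) / (1 - O' (t (2 * l + 1)))) = t (2 * l + 1)" for l
  proof -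
    have "O' u / (1 - O' u) = u ^ 6" for u
    proof -
      have "0 < 1 + u ^ 6" by (simp add: add_pos_nonneg)
      then have "1 - O' u = 1 / (1 + u ^ 6)" by (simp add: O'_def field_simps)
      then show ?thesis using \<open>0 < 1 + u ^ 6\<close> by (simp add: O'_def)
    qed
    moreover have "0 \<le> t (2 * l + 1)" using thi[of l] by linarith
    ultimately show ?thesis by (simp add: real_root_power_cancel)
  qed
  ultimately have h: "(\<lambda>l. t (2 * l + 1)) \<longlonglongrightarrow> h" by simp
  have hb: "12/13 \<le> h" "h \<le> 1"
    using thi LIMSEQ_le_const[OF h, of "12/13"] LIMSEQ_le_const2[OF h, of 1] by blast+
  have "(\<lambda>l. t (2 * Suc l)) \<longlonglongrightarrow> T h"
    using contT[OF h] hb by (simp add: tS)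
  then have l: "(\<lambda>l. t (2 * l)) \<longlonglongrightarrow> T h"
    by (rule LIMSEQ_imp_Suc)
  have lb: "0 \<le> T h" "T h \<le> 3/5" using T2[OF hb(1)] by auto
  have "(\<lambda>l. t (2 * l + 1)) \<longlonglongrightarrow> T (T h)"
    using contT[OF l lb(1)] by (simp add: tS)
  with h have TT: "T (T h) = h" using LIMSEQ_unique by blast
  have p: "p = O' h" using LIMSEQ_unique[OF hi contO[OF h, unfolded O'_def]] by (simp add: O'_def)
  have p': "p' = O' (T h)" using LIMSEQ_unique[OF lo contO[OF l, unfolded O'_def]] by (simp add: O'_def)
  define x where "x = T h ^ 5"
  define y where "y = h ^ 5"
  have hx: "h = 1 / (1 + x)" using TT by (simp add: x_def T_def)
  have hy: "T h = 1 / (1 + y)" by (simp add: y_def T_def)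
  have y: "2/3 \<le> y" "y \<le> 1"
  proof -
    have "(12/13) ^ 5 \<le> h ^ 5" using hb by (intro power_mono) auto
    moreover have "2/3 \<le> (12/13 :: real) ^ 5" by (simp add: power_divide)
    ultimately show "2/3 \<le> y" unfolding y_def by linarith
    show "y \<le> 1" using hb by (auto simp: y_def intro: power_le_one)
  qed
  have x: "0 < x" "x \<le> 1/12"
  proof -
    show "0 < x" using y unfolding x_def hy by simp
    have "T h ^ 5 \<le> (3/5) ^ 5" using lb by (intro power_mono) auto
    also have "(3/5 :: real) ^ 5 \<le> 1/12" by (simp add: power_divide)
    finally show "x \<le> 1/12" unfolding x_def .
  qed
  have xy: "x * (1 + y) ^ 5 = 1"
    using y unfolding x_def hy by (simp add: power_divide)
  have yx: "y * (1 + x) ^ 5 = 1"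
    using x unfolding y_def hx by (simp add: power_divide)
  interpret two_phase x y
    using x y xy yx by unfold_locales
  show thesis
  proof (rule that)
    show "two_phase x y" by unfold_locales
    have e: "u ^ 6 = u ^ 5 * u" for u :: real by (simp add: eval_nat_numeral)
    have "h ^ 6 = y / (1 + x)" using hx by (simp add: e y_def)
    then have "p = (y / (1 + x)) / (1 + y / (1 + x))" by (simp add: p O'_def)
    also have "1 + y / (1 + x) = Z / (1 + x)" using x by (simp add: Z_def field_simps)
    finally show "p = p_high" using x by (simp add: p_high_def)
    have "T h ^ 6 = x / (1 + y)" using hy by (simp add: e x_def)
    then have "p' = (x / (1 + y)) / (1 + x / (1 + y))" by (simp add: p' O'_def)
    also have "1 + x / (1 + y) = Z / (1 + y)" using y by (simp add: Z_def field_simps)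
    finally show "p' = p_low" using y by (simp add: p_low_def)
  qed
qed

lemma gibbs_densities:
  assumes "gibbs_plus 6 1 M" "gibbs_minus 6 1 M'"
  obtains x y where "two_phase x y"
    "root_density M = two_phase.p_high x y" "root_density M' = two_phase.p_low x y"
proof (rule two_phase_of_recursion[of "vacancy 5"])
  have e: "full_level_prob 6 1 (Suc n) {I. I \<inter> {tree_root} = {tree_root}}
      = vacancy 5 n ^ 6 / (1 + vacancy 5 n ^ 6)" for n
    using full_level_prob_root[of 5 n] by simp
  \<comment> \<open>A full level \<open>2 * Suc l\<close> leaves branches of odd depth
    \<open>2 * l + 1\<close>, so the plus phase reads the odd vacancies. The term for level 0, the
    root itself, is dropped by the shift.\<close>
  have "(\<lambda>l. full_level_prob 6 1 (2 * Suc l) {I. I \<inter> {tree_root} = {tree_root}}) \<longlonglongrightarrow> root_density M"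
    using LIMSEQ_Suc[OF root_density_limit[OF assms(1)[unfolded gibbs_plus_def]]] .
  then show "(\<lambda>l. vacancy 5 (2 * l + 1) ^ 6 / (1 + vacancy 5 (2 * l + 1) ^ 6)) \<longlonglongrightarrow> root_density M"
    by (simp add: e)
  show "(\<lambda>l. vacancy 5 (2 * l) ^ 6 / (1 + vacancy 5 (2 * l) ^ 6)) \<longlonglongrightarrow> root_density M'"
    using root_density_limit[OF assms(2)[unfolded gibbs_minus_def]] by (simp add: e)
qed (use that in \<open>auto simp: vacancy_0 vacancy_Suc\<close>)

text \<open>With these constants, comparing the profile at \<open>s\<close> and at 1 is the
  contraction multiplied by \<open>(1 - \<alpha>) ^ 5\<close>. The point 1 is critical for all
  densities, not only at the phases.\<close>

lemma contracts_of_profile: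
  assumes p: "0 < \<alpha>" "0 < \<beta>" "\<alpha> + \<beta> < 1" and s: "0 \<le> s" and c: "0 \<le> c"
    and turn: "\<And>x. min s 1 \<le> x \<Longrightarrow> x \<le> max s 1 \<Longrightarrow>
      \<beta> * x ^ 5 * (24 * (1 - \<beta>) - 25 * (1 - \<alpha> - \<beta>) * x) - (1 - \<alpha> - \<beta>) * (1 - \<beta>) \<le> 0"
  shows "contracts \<alpha> \<beta> c (s * c)"
proof -
  define k where "k = 1 - \<alpha> - \<beta>"
  interpret edge_profile k \<beta> "1 - \<beta>" "\<alpha> * (1 - \<alpha>) ^ 5"
    using p by unfold_locales (auto simp: k_def)
  have sl: "slope 1 = 0" unfolding slope_def by (simp add: k_def)
  have "turn x \<le> 0" if "min s 1 \<le> x" "x \<le> max s 1" for x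
    unfolding turn_def using turn[OF that] by (simp add: k_def)
  then have "profile s \<le> profile 1"
    using s by (intro profile_le_critical sl) auto
  moreover have "profile 1 = ln ((1 - \<alpha>) ^ 5)"
  proof -
    have "(k + \<beta> * 1 ^ 5) ^ 6 + \<alpha> * (1 - \<alpha>) ^ 5 = (1 - \<alpha>) ^ 5"
      by (simp add: k_def) (simp add: eval_nat_numeral algebra_simps)
    then show ?thesis unfolding profile_def by simp
  qed
  ultimately have le: "ln ((k + \<beta> * s ^ 5) ^ 6 + \<alpha> * (1 - \<alpha>) ^ 5)
      \<le> ln ((1 - \<alpha>) ^ 5 * (1 - \<beta> + \<beta> * s ^ 6) ^ 5)"
    using p D_pos[OF s] unfolding profile_def by (simp add: ln_mult ln_realpow)
  have "(k + \<beta> * s ^ 5) ^ 6 + \<alpha> * (1 - \<alpha>) ^ 5 \<le> (1 - \<alpha>) ^ 5 * (1 - \<beta> + \<beta> * s ^ 6) ^ 5"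
    using p P_pos[OF s] D_pos[OF s]
    by (intro ln_le_cancel_iff[THEN iffD1, OF _ _ le]) (auto intro: add_pos_pos)
  then have key: "((k + \<beta> * s ^ 5) ^ 6 / (1 - \<alpha>) ^ 5 + \<alpha>) * c ^ 30 \<le> (1 - \<beta> + \<beta> * s ^ 6) ^ 5 * c ^ 30"
    using p c by (intro mult_right_mono) (auto simp: field_simps)
  have "(1 - \<alpha>) * ((k * c ^ 5 + \<beta> * (s * c) ^ 5) / (1 - \<alpha>)) ^ 6 + \<alpha> * (c ^ 5) ^ 6
      = ((k + \<beta> * s ^ 5) ^ 6 / (1 - \<alpha>) ^ 5 + \<alpha>) * c ^ 30"
  proof -
    have n: "k * c ^ 5 + \<beta> * (s * c) ^ 5 = (k + \<beta> * s ^ 5) * c ^ 5"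
      by (simp add: power_mult_distrib algebra_simps)
    have "A * (w * v / A) ^ 6 = w ^ 6 / A ^ 5 * v ^ 6" if "A \<noteq> 0" for A w v :: real
      using that by (simp add: eval_nat_numeral mult.commute mult.left_commute)
    from this[of "1 - \<alpha>" "k + \<beta> * s ^ 5" "c ^ 5"] show ?thesis
      unfolding n using p by (simp only: distrib_right) (simp add: power_mult[symmetric])
  qed
  also have "\<dots> \<le> ((1 - \<beta> + \<beta> * s ^ 6) * c ^ 6) ^ 5"
    using key by (simp add: power_mult_distrib power_mult[symmetric])
  also have "(1 - \<beta> + \<beta> * s ^ 6) * c ^ 6 = (1 - \<beta>) * c ^ 6 + \<beta> * (s * c) ^ 6"
    by (simp add: power_mult_distrib algebra_simps)
  finally show ?thesis unfolding contracts_def k_def .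
qed

lemma contracts_near:
  assumes p: "0 < \<alpha>\<^sub>0" "0 < \<beta>\<^sub>0" "\<alpha>\<^sub>0 + \<beta>\<^sub>0 < 1"
    and stable: "\<beta>\<^sub>0 * (24 * (1 - \<beta>\<^sub>0) - 25 * (1 - \<alpha>\<^sub>0 - \<beta>\<^sub>0)) - (1 - \<alpha>\<^sub>0 - \<beta>\<^sub>0) * (1 - \<beta>\<^sub>0) < 0"
  shows "eventually (\<lambda>(\<alpha>, \<beta>, s). \<forall>c\<ge>0. contracts \<alpha> \<beta> c (s * c)) (nhds (\<alpha>\<^sub>0, \<beta>\<^sub>0, 1))"
proof -
  let ?S = "{w :: real \<times> real \<times> real. 0 < fst w \<and> 0 < fst (snd w) \<and> fst w + fst (snd w) < 1 \<and> 0 < snd (snd w) \<and>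
    fst (snd w) * snd (snd w) ^ 5 * (24 * (1 - fst (snd w)) - 25 * (1 - fst w - fst (snd w)) * snd (snd w))
      - (1 - fst w - fst (snd w)) * (1 - fst (snd w)) < 0}"
  have "open ?S"
    by (intro open_Collect_conj open_Collect_less continuous_intros)
  moreover have "(\<alpha>\<^sub>0, \<beta>\<^sub>0, 1) \<in> ?S" using p stable by simp
  ultimately obtain e where e: "0 < e" "ball (\<alpha>\<^sub>0, \<beta>\<^sub>0, 1) e \<subseteq> ?S"
    by (rule openE)
  have "\<forall>c\<ge>0. contracts \<alpha> \<beta> c (s * c)" if w: "dist (\<alpha>, \<beta>, s) (\<alpha>\<^sub>0, \<beta>\<^sub>0, 1) < e" for \<alpha> \<beta> s
  proof -
    \<comment> \<open>Moving the last coordinate towards 1 stays in the ball, so the sign of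
      \<open>turn\<close> is controlled on the whole segment between \<open>s\<close> and 1.\<close>
    have S: "(\<alpha>, \<beta>, x) \<in> ?S" if "min s 1 \<le> x" "x \<le> max s 1" for x
    proof -
      have "\<bar>x - 1\<bar> \<le> \<bar>s - 1\<bar>" using that by auto
      then have "dist (\<alpha>, \<beta>, x) (\<alpha>\<^sub>0, \<beta>\<^sub>0, 1) \<le> dist (\<alpha>, \<beta>, s) (\<alpha>\<^sub>0, \<beta>\<^sub>0, 1)"
        unfolding dist_Pair_Pair dist_real_def
        by (intro real_sqrt_le_mono add_left_mono) (simp add: abs_le_square_iff[symmetric])
      with w have "(\<alpha>, \<beta>, x) \<in> ball (\<alpha>\<^sub>0, \<beta>\<^sub>0, 1) e" by (simp add: dist_commute)
      with e show ?thesis by blast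
    qed
    show ?thesis
      using S[of s] S by (intro allI impI contracts_of_profile) (auto simp: less_imp_le)
  qed
  then show ?thesis
    unfolding eventually_nhds_metric using e(1) by (intro exI[of _ e]) auto
qed

section \<open>Compactness\<close>

text \<open>Unlike \<open>f_fun\<close>, this expression is continuous on the whole space.\<close>

definition exponent_ext :: "real \<times> real \<times> real \<times> real \<times> real \<Rightarrow> real" where
  "exponent_ext = (\<lambda>(\<alpha>, \<beta>, \<gamma>, \<delta>, \<epsilon>).
     5 * (xlnx \<gamma> + 2 * xlnx (\<alpha> - \<gamma>) + xlnx (1 - 2 * \<alpha> + \<gamma>))
     + 5 * (xlnx \<delta> + 2 * xlnx (\<beta> - \<delta>) + xlnx (1 - 2 * \<beta> + \<delta>))
     - 6 * (xlnx \<gamma> + xlnx \<epsilon> + xlnx (\<alpha> - \<gamma> - \<epsilon>) + xlnx (\<beta> - \<delta> - (\<alpha> - \<gamma> - \<epsilon>))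
        + xlnx (1 - 2 * \<beta> + \<delta> - \<gamma> - \<epsilon>) + xlnx (\<beta> - \<delta>) + xlnx \<delta>
        - (xlnx (1 - \<beta> - \<gamma> - \<epsilon>) - xlnx (\<alpha> - \<gamma>) - xlnx (1 - \<beta> - \<gamma> - \<epsilon> - (\<alpha> - \<gamma>)))))"

lemma f_fun_eq_exponent_ext:
  assumes "(\<gamma>, \<delta>, \<epsilon>) \<in> region \<alpha> \<beta>"
  shows "f_fun 6 1 \<alpha> \<beta> \<gamma> \<delta> \<epsilon> = exponent_ext (\<alpha>, \<beta>, \<gamma>, \<delta>, \<epsilon>)"
proof -
  have "0 \<le> \<alpha> - \<gamma>" "\<alpha> - \<gamma> \<le> 1 - \<beta> - \<gamma> - \<epsilon>"
    using assms by (auto simp: region_def H1_defined_def)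
  then show ?thesis
    unfolding f_fun_eq_xlnx_H1[OF assms] exponent_ext_def prod.case by (simp only: H1_eq_xlnx[OF _ _ refl])
qed

lemma continuous_exponent_ext: "continuous_on UNIV exponent_ext"
  unfolding exponent_ext_def case_prod_unfold by (intro continuous_intros)

lemma continuous_product_exponent: "continuous_on UNIV (\<lambda>w. product_exponent (fst w) (fst (snd w)))"
proof -
  have e: "product_exponent \<alpha> \<beta> = 10 * xlnx (1 - \<alpha>) + 10 * xlnx (1 - \<beta>)
     - 2 * xlnx \<alpha> - 2 * xlnx \<beta> - 12 * xlnx (1 - \<alpha> - \<beta>)" for \<alpha> \<beta>
    unfolding product_exponent_def xlnx_def by (simp only: mult.assoc)
  show ?thesis unfolding e by (intro continuous_intros)
qed

lemma compact_regions: "compact {(\<alpha>, \<beta>, z). z \<in> region \<alpha> \<beta>}" (is "compact ?K")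
proof -
  have "closed ?K"
    unfolding region_def H1_defined_def case_prod_unfold mem_Collect_eq
    by (intro closed_Collect_conj closed_Collect_le continuous_intros)
  moreover have "bounded ?K"
  proof (rule bounded_subset)
    show "?K \<subseteq> {0..1} \<times> {0..1} \<times> {0..1} \<times> {0..1} \<times> {0..1}"
      by (auto simp: region_def H1_defined_def)
    show "bounded ({0..1::real} \<times> {0..1::real} \<times> {0..1::real} \<times> {0..1::real} \<times> {0..1::real})"
      by (intro bounded_Times bounded_closed_interval)
  qed
  ultimately show ?thesis by (simp add: compact_eq_bounded_closed)
qed

section \<open>Local contraction and the maximum at nearby densities\<close>

definition contracting :: "real \<times> real \<times> real \<times> real \<times> real \<Rightarrow> bool" where
  "contracting = (\<lambda>(\<alpha>, \<beta>, \<gamma>, \<delta>, \<epsilon>).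
      contracts \<alpha> \<beta> (density_root (1 - 2 * \<beta> + \<delta>) ((1 - \<beta>) * (1 - \<beta>)))
         (density_root (\<beta> - \<delta>) (\<beta> * (1 - \<beta>)))
    \<and> contracts \<alpha> \<beta> (density_root (\<beta> - \<delta>) (\<beta> * (1 - \<beta>))) (density_root \<delta> (\<beta> * \<beta>)))"

definition product_point :: "real \<Rightarrow> real \<Rightarrow> real \<times> real \<times> real" where
  "product_point \<alpha> \<beta> = (\<alpha>\<^sup>2, \<beta>\<^sup>2, \<alpha> * (1 - \<alpha> - \<beta>))"

lemma g_fun_less_product_point:
  assumes p: "0 < \<alpha>" "0 < \<beta>" "\<alpha> + \<beta> < 1"
    and z: "z \<in> region \<alpha> \<beta>" "z \<noteq> product_point \<alpha> \<beta>" and c: "contracting (\<alpha>, \<beta>, z)"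
  shows "g_fun 6 1 \<alpha> \<beta> z < g_fun 6 1 \<alpha> \<beta> (product_point \<alpha> \<beta>)"
proof -
  obtain \<gamma> \<delta> \<epsilon> where ze: "z = (\<gamma>, \<delta>, \<epsilon>)" by (cases z)
  show ?thesis
    using f_fun_le_product_point[OF p, of \<gamma> \<delta> \<epsilon>] z c
    unfolding ze contracting_def product_point_def g_fun_def prod.case not_le[symmetric] by blast
qed

text \<open>At the product point all three density roots are 1, so nearby the quotients of
  consecutive ones are close to 1; they serve as s in \<open>contracts_near\<close>.\<close>

lemma eventually_contracting:
  assumes p: "0 < \<alpha>\<^sub>0" "0 < \<beta>\<^sub>0" "\<alpha>\<^sub>0 + \<beta>\<^sub>0 < 1"
    and stable: "\<beta>\<^sub>0 * (24 * (1 - \<beta>\<^sub>0) - 25 * (1 - \<alpha>\<^sub>0 - \<beta>\<^sub>0)) - (1 - \<alpha>\<^sub>0 - \<beta>\<^sub>0) * (1 - \<beta>\<^sub>0) < 0"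
  shows "eventually contracting (nhds (\<alpha>\<^sub>0, \<beta>\<^sub>0, product_point \<alpha>\<^sub>0 \<beta>\<^sub>0))"
proof -
  let ?w = "(\<alpha>\<^sub>0, \<beta>\<^sub>0, product_point \<alpha>\<^sub>0 \<beta>\<^sub>0)"
  define b where "b = (\<lambda>w :: real \<times> real \<times> real \<times> real \<times> real. fst (snd w))"
  define d where "d = (\<lambda>w :: real \<times> real \<times> real \<times> real \<times> real. fst (snd (snd (snd w))))"
  define c\<^sub>0 where "c\<^sub>0 w = density_root (1 - 2 * b w + d w) ((1 - b w) * (1 - b w))" for w
  define c\<^sub>1 where "c\<^sub>1 w = density_root (b w - d w) (b w * (1 - b w))" for w
  define c\<^sub>2 where "c\<^sub>2 w = density_root (d w) (b w * b w)" for w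
  have lim [tendsto_intros]: "(fst \<longlongrightarrow> \<alpha>\<^sub>0) (nhds ?w)" "(b \<longlongrightarrow> \<beta>\<^sub>0) (nhds ?w)" "(d \<longlongrightarrow> \<beta>\<^sub>0 * \<beta>\<^sub>0) (nhds ?w)"
    unfolding b_def d_def
    by (auto intro!: tendsto_eq_intros filterlim_ident simp: product_point_def power2_eq_square)
  have pos: "\<beta>\<^sub>0 \<noteq> 0" "1 - \<beta>\<^sub>0 \<noteq> 0" using p by auto
  have "(c\<^sub>0 \<longlongrightarrow> root 6 ((1 - 2 * \<beta>\<^sub>0 + \<beta>\<^sub>0 * \<beta>\<^sub>0) / ((1 - \<beta>\<^sub>0) * (1 - \<beta>\<^sub>0)))) (nhds ?w)"
    unfolding c\<^sub>0_def[abs_def] density_root_def using pos by (intro tendsto_intros lim) auto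
  moreover have "1 - 2 * \<beta>\<^sub>0 + \<beta>\<^sub>0 * \<beta>\<^sub>0 = (1 - \<beta>\<^sub>0) * (1 - \<beta>\<^sub>0)" by (simp add: algebra_simps)
  ultimately have l0: "(c\<^sub>0 \<longlongrightarrow> 1) (nhds ?w)" using pos by simp
  have "(c\<^sub>1 \<longlongrightarrow> root 6 ((\<beta>\<^sub>0 - \<beta>\<^sub>0 * \<beta>\<^sub>0) / (\<beta>\<^sub>0 * (1 - \<beta>\<^sub>0)))) (nhds ?w)"
    unfolding c\<^sub>1_def[abs_def] density_root_def using pos by (intro tendsto_intros lim) auto
  moreover have "\<beta>\<^sub>0 - \<beta>\<^sub>0 * \<beta>\<^sub>0 = \<beta>\<^sub>0 * (1 - \<beta>\<^sub>0)" by (simp add: algebra_simps)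
  ultimately have l1: "(c\<^sub>1 \<longlongrightarrow> 1) (nhds ?w)" using pos by simp
  have "(c\<^sub>2 \<longlongrightarrow> root 6 ((\<beta>\<^sub>0 * \<beta>\<^sub>0) / (\<beta>\<^sub>0 * \<beta>\<^sub>0))) (nhds ?w)"
    unfolding c\<^sub>2_def[abs_def] density_root_def using pos by (intro tendsto_intros lim) auto
  then have l2: "(c\<^sub>2 \<longlongrightarrow> 1) (nhds ?w)" using pos by simp
  have r1: "((\<lambda>w. c\<^sub>1 w / c\<^sub>0 w) \<longlongrightarrow> 1) (nhds ?w)" and r2: "((\<lambda>w. c\<^sub>2 w / c\<^sub>1 w) \<longlongrightarrow> 1) (nhds ?w)"
    using tendsto_divide[OF l1 l0] tendsto_divide[OF l2 l1] by simp_all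
  have near: "eventually (\<lambda>w. \<forall>c\<ge>0. contracts (fst w) (b w) c (r w * c)) (nhds ?w)"
    if "(r \<longlongrightarrow> 1) (nhds ?w)" for r
  proof -
    have "filterlim (\<lambda>w. (fst w, b w, r w)) (nhds (\<alpha>\<^sub>0, \<beta>\<^sub>0, 1)) (nhds ?w)"
      by (intro tendsto_Pair lim that)
    from eventually_compose_filterlim[OF contracts_near[OF p stable] this] show ?thesis by simp
  qed
  have pos0: "eventually (\<lambda>w. 0 < c\<^sub>0 w) (nhds ?w)" and pos1: "eventually (\<lambda>w. 0 < c\<^sub>1 w) (nhds ?w)"
    using order_tendstoD(1)[OF l0, of 0] order_tendstoD(1)[OF l1, of 0] by simp_all
  have "eventually (\<lambda>w. contracts (fst w) (b w) (c\<^sub>0 w) (c\<^sub>1 w) \<and> contracts (fst w) (b w) (c\<^sub>1 w) (c\<^sub>2 w)) (nhds ?w)"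
    using near[OF r1] near[OF r2] pos0 pos1
  proof eventually_elim
    case (elim w)
    show ?case
      using elim(1)[rule_format, of "c\<^sub>0 w"] elim(2)[rule_format, of "c\<^sub>1 w"] elim(3,4) by simp
  qed
  then show ?thesis
    by (simp add: contracting_def case_prod_unfold c\<^sub>0_def c\<^sub>1_def c\<^sub>2_def b_def d_def)
qed

lemma unique_max_near:
  assumes p: "0 < \<alpha>\<^sub>0" "0 < \<beta>\<^sub>0" "\<alpha>\<^sub>0 + \<beta>\<^sub>0 < 1"
    and stable: "\<beta>\<^sub>0 * (24 * (1 - \<beta>\<^sub>0) - 25 * (1 - \<alpha>\<^sub>0 - \<beta>\<^sub>0)) - (1 - \<alpha>\<^sub>0 - \<beta>\<^sub>0) * (1 - \<beta>\<^sub>0) < 0"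
    and global: "\<And>c\<^sub>0 c\<^sub>1. 0 \<le> c\<^sub>0 \<Longrightarrow> 0 \<le> c\<^sub>1 \<Longrightarrow> contracts \<alpha>\<^sub>0 \<beta>\<^sub>0 c\<^sub>0 c\<^sub>1"
  obtains chi where "0 < chi" "\<And>\<alpha> \<beta>. \<bar>\<beta>\<^sub>0 - \<beta>\<bar> < chi \<Longrightarrow> \<bar>\<alpha>\<^sub>0 - \<alpha>\<bar> < chi \<Longrightarrow>
    attains_unique_max_on (g_fun 6 1 \<alpha> \<beta>) (region \<alpha> \<beta>) (product_point \<alpha> \<beta>)"
proof -
  obtain U where U: "open U" "(\<alpha>\<^sub>0, \<beta>\<^sub>0, product_point \<alpha>\<^sub>0 \<beta>\<^sub>0) \<in> U" "\<And>w. w \<in> U \<Longrightarrow> contracting w"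
    using eventually_contracting[OF p stable] unfolding eventually_nhds by blast
  define K where "K = {(\<alpha>, \<beta>, z). z \<in> region \<alpha> \<beta>}"
  \<comment> \<open>Competitors outside the neighbourhood where the contraction is known, over all
    densities at once. Writing f as \<open>exponent_ext\<close> makes this set closed.\<close>
  define B where "B = K \<inter> (- U \<inter> {w. product_exponent (fst w) (fst (snd w)) \<le> exponent_ext w})"
  have "compact B"
    unfolding B_def K_def using U(1)
    by (intro compact_Int_closed compact_regions closed_Int closed_Compl closed_Collect_le
        continuous_product_exponent continuous_exponent_ext)
  have B_iff: "(\<alpha>, \<beta>, z) \<in> B \<longleftrightarrow> z \<in> region \<alpha> \<beta> \<and> (\<alpha>, \<beta>, z) \<notin> U \<and>
      g_fun 6 1 \<alpha> \<beta> (product_point \<alpha> \<beta>) \<le> g_fun 6 1 \<alpha> \<beta> z"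
    if "0 < \<alpha>" "0 < \<beta>" "\<alpha> + \<beta> < 1" for \<alpha> \<beta> z
    using f_fun_product_point[OF that]
    by (cases z) (auto simp: B_def K_def g_fun_def product_point_def f_fun_eq_exponent_ext)
  define D where "D = (\<lambda>w :: real \<times> real \<times> real \<times> real \<times> real. \<bar>\<alpha>\<^sub>0 - fst w\<bar> + \<bar>\<beta>\<^sub>0 - fst (snd w)\<bar>)"
  \<comment> \<open>A point of \<open>B\<close> with \<open>D = 0\<close> would be a competitor at
    the exact densities, where the contraction is global. Hence \<open>D\<close> has a positive
    minimum on the compact set \<open>B\<close>, and closer densities admit no competitor.\<close>
  have D0: "D w \<noteq> 0" if "w \<in> B" for w
  proof
    assume "D w = 0"
    then have "fst w = \<alpha>\<^sub>0" "fst (snd w) = \<beta>\<^sub>0" by (auto simp: D_def)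
    then obtain z where w: "w = (\<alpha>\<^sub>0, \<beta>\<^sub>0, z)" by (metis prod.collapse)
    have z: "z \<in> region \<alpha>\<^sub>0 \<beta>\<^sub>0" "(\<alpha>\<^sub>0, \<beta>\<^sub>0, z) \<notin> U"
      "g_fun 6 1 \<alpha>\<^sub>0 \<beta>\<^sub>0 (product_point \<alpha>\<^sub>0 \<beta>\<^sub>0) \<le> g_fun 6 1 \<alpha>\<^sub>0 \<beta>\<^sub>0 z"
      using that B_iff[OF p] unfolding w by blast+
    obtain \<gamma> \<delta> \<epsilon> where ze: "z = (\<gamma>, \<delta>, \<epsilon>)" by (cases z)
    have "0 \<le> \<delta>" "0 \<le> \<beta>\<^sub>0 - \<delta>" "0 \<le> 1 - 2 * \<beta>\<^sub>0 + \<delta>"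
      using z(1) by (auto simp: ze region_def H1_defined_def)
    then have "contracting (\<alpha>\<^sub>0, \<beta>\<^sub>0, z)"
      using p unfolding contracting_def ze prod.case
      by (intro conjI global density_root mult_pos_pos) auto
    moreover have "z \<noteq> product_point \<alpha>\<^sub>0 \<beta>\<^sub>0" using z(2) U(2) by auto
    ultimately show False
      using g_fun_less_product_point[OF p z(1)] z(3) by simp
  qed
  have contD: "continuous_on B D" unfolding D_def by (intro continuous_intros)
  obtain m where m: "0 < m" "\<And>w. w \<in> B \<Longrightarrow> m \<le> D w"
  proof (cases "B = {}")
    case False
    obtain w where w: "w \<in> B" "\<And>v. v \<in> B \<Longrightarrow> D w \<le> D v"
      using continuous_attains_inf[OF \<open>compact B\<close> False contD] by blast
    have "0 \<le> D w" by (simp add: D_def)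
    with D0[OF w(1)] have "0 < D w" by simp
    with w(2) show thesis using that by blast
  qed (use that[of 1] in auto)
  define chi where "chi = min (min (m / 2) \<alpha>\<^sub>0) (min \<beta>\<^sub>0 ((1 - \<alpha>\<^sub>0 - \<beta>\<^sub>0) / 2))"
  have chi: "chi \<le> m / 2" "chi \<le> \<alpha>\<^sub>0" "chi \<le> \<beta>\<^sub>0" "chi \<le> (1 - \<alpha>\<^sub>0 - \<beta>\<^sub>0) / 2" "0 < chi"
    unfolding chi_def using m(1) p by (linarith | simp)+
  show thesis
  proof (rule that[OF chi(5)])
    fix \<alpha> \<beta> assume near: "\<bar>\<beta>\<^sub>0 - \<beta>\<bar> < chi" "\<bar>\<alpha>\<^sub>0 - \<alpha>\<bar> < chi"
    have close: "\<alpha> < \<alpha>\<^sub>0 + chi" "\<alpha>\<^sub>0 - chi < \<alpha>" "\<beta> < \<beta>\<^sub>0 + chi" "\<beta>\<^sub>0 - chi < \<beta>"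
      using near by linarith+
    have "\<alpha> + \<beta> < \<alpha>\<^sub>0 + \<beta>\<^sub>0 + 2 * chi" using close by linarith
    also have "\<dots> \<le> 1" using chi(4) by simp
    finally have q: "0 < \<alpha>" "0 < \<beta>" "\<alpha> + \<beta> < 1" using close chi(2,3) by linarith+
    have "g_fun 6 1 \<alpha> \<beta> z < g_fun 6 1 \<alpha> \<beta> (product_point \<alpha> \<beta>)"
      if z: "z \<in> region \<alpha> \<beta>" "z \<noteq> product_point \<alpha> \<beta>" for z
    proof (cases "(\<alpha>, \<beta>, z) \<in> U")
      case True
      then show ?thesis using g_fun_less_product_point[OF q z] U(3) by blast
    next
      case False
      have "D (\<alpha>, \<beta>, z) < m" using near chi unfolding D_def by simp
      with m(2) have "(\<alpha>, \<beta>, z) \<notin> B" by fastforce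
      with B_iff[OF q, of z] z(1) False show ?thesis by linarith
    qed
    then show "attains_unique_max_on (g_fun 6 1 \<alpha> \<beta>) (region \<alpha> \<beta>) (product_point \<alpha> \<beta>)"
      using product_point_in_region[OF q] by (simp add: attains_unique_max_on_def product_point_def)
  qed
qed

theorem mainTheorem15:
  fixes d :: nat and lam :: real and \<mu>_plus \<mu>_minus :: "(nat list \<Rightarrow> bool) measure"
    and p_plus p_minus :: real
  assumes "d = 6" and "lam = 1"
    and "gibbs_plus d lam \<mu>_plus" and "gibbs_minus d lam \<mu>_minus"
    and "p_plus = root_density \<mu>_plus" and "p_minus = root_density \<mu>_minus"
  shows "\<exists>chi>0. \<forall>\<alpha> \<beta> :: real. \<bar>p_plus - \<beta>\<bar> < chi \<and> \<bar>p_minus - \<alpha>\<bar> < chi \<longrightarrow>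
           attains_unique_max_on (g_fun d lam \<alpha> \<beta>) (region \<alpha> \<beta>)
             (\<alpha>\<^sup>2, \<beta>\<^sup>2, \<alpha> * (1 - \<alpha> - \<beta>))"
proof -
  obtain x y where xy: "two_phase x y"
    and pq: "p_plus = two_phase.p_high x y" "p_minus = two_phase.p_low x y"
    using gibbs_densities[of \<mu>_plus \<mu>_minus] assms by metis
  interpret two_phase x y by (rule xy)
  obtain chi where "0 < chi" "\<And>\<alpha> \<beta>. \<bar>p_high - \<beta>\<bar> < chi \<Longrightarrow> \<bar>p_low - \<alpha>\<bar> < chi \<Longrightarrow>
    attains_unique_max_on (g_fun 6 1 \<alpha> \<beta>) (region \<alpha> \<beta>) (product_point \<alpha> \<beta>)"
    using unique_max_near[OF densities densities_stable contracts_densities] by blast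
  then show ?thesis
    unfolding assms(1,2) pq product_point_def by blast
qed

end
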